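(* Suppose $n\geqslant 3$ and let $P_n(z)=1+z+\dots+z^{n-1}$. 1) Both $\widetilde{\beta_n}(t)$ and $\widehat{\beta_n}(t)$ are representations of $WB_n$. 2) For every $z\in\mathbb{C}^*$, both $\widetilde{\beta_n}(z)$ and $\widehat{\beta_n}(z)$ are $(n-1)$-dimensional complex representations of $WB_n$. If $P_n(z)\neq 0$, then the restrictions of both $\widetilde{\beta_n}(z)$ and $\widehat{\beta_n}(z)$ to the braid group $B_n$ are equivalent to an irreducible reduced Burau representation $\beta_n(z)$. 3) For all $z_1,z_2\in\mathbb{C}^*$ such that $P_n(z_1)\neq 0$, $P_n(z_2)\neq 0$ and $z_1\neq z_2$: (a) the representations $\widetilde{\beta_n}(z_1)$ and $\widetilde{\beta_n}(z_2)$ are not equivalent; (b) the representations $\widehat{\beta_n}(z_1)$ and $\widehat{\beta_n}(z_2)$ are not equivalent; (c) the representations $\widetilde{\beta_n}(z_1)$ and $\widehat{\beta_n}(z_2)$ are not equivalent. 4) For every $z\in\mathbb{C}^*$ such that $P_n(z)\neq 0$, the representations $\widetilde{\beta_n}(z)$ and $\widehat{\beta_n}(z)$ are not equivalent, except when $z=1$, in which case $\widetilde{\beta_n}(1)$ is equivalent to $\widehat{\beta_n}(1)$.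
   Context: The welded braid group $WB_n$ is the group generated by $\alpha_1,\dots,\alpha_{n-1},\sigma_1,\dots,\sigma_{n-1}$ with defining relations: $\alpha_i^2=1$ ($1\leqslant i\leqslant n-1$); $\alpha_i\alpha_j=\alpha_j\alpha_i$, $\sigma_i\sigma_j=\sigma_j\sigma_i$, $\alpha_i\sigma_j=\sigma_j\alpha_i$ for $|i-j|\geqslant 2$; and, for $1\leqslant i\leqslant n-2$, $\alpha_i\alpha_{i+1}\alpha_i=\alpha_{i+1}\alpha_i\alpha_{i+1}$, $\sigma_i\sigma_{i+1}\sigma_i=\sigma_{i+1}\sigma_i\sigma_{i+1}$, $\alpha_i\alpha_{i+1}\sigma_i=\sigma_{i+1}\alpha_i\alpha_{i+1}$, $\sigma_i\sigma_{i+1}\alpha_i=\alpha_{i+1}\sigma_i\sigma_{i+1}$. The subgroup generated by the $\sigma_i$ is isomorphic to the braid group on $n$ strings and is denoted $B_n$. Let $t$ be an indeterminate. Below $I_m$ is the $m\times m$ identity, $\oplus$ denotes block-diagonal sum, and $2\leqslant i\leqslant n-2$. The reduced Burau representation $\beta_n(t):B_n\to GL_{n-1}(\mathbb{C}[t^{\pm1}])$ is $$\beta_n(t)(\sigma_1)=\begin{pmatrix}-t&0\\1&1\end{pmatrix}\oplus I_{n-3},\quad \beta_n(t)(\sigma_i)=I_{i-2}\oplus\begin{pmatrix}1&t&0\\0&-t&0\\0&1&1\end{pmatrix}\oplus I_{n-i-2},\quad \beta_n(t)(\sigma_{n-1})=I_{n-3}\oplus\begin{pmatrix}1&t\\0&-t\end{pmatrix}.$$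 The maps $\widetilde{\beta_n}(t),\widehat{\beta_n}(t):WB_n\to GL_{n-1}(\mathbb{C}[t^{\pm1}])$ are defined on generators by $$\widetilde{\beta_n}(t)(\sigma_1)=\begin{pmatrix}-t&1\\0&1\end{pmatrix}\oplus I_{n-3},\quad \widetilde{\beta_n}(t)(\sigma_i)=I_{i-2}\oplus\begin{pmatrix}1&0&0\\t&-t&1\\0&0&1\end{pmatrix}\oplus I_{n-i-2},\quad \widetilde{\beta_n}(t)(\sigma_{n-1})=I_{n-3}\oplus\begin{pmatrix}1&0\\t&-t\end{pmatrix},$$ $$\widetilde{\beta_n}(t)(\alpha_1)=\begin{pmatrix}-1&1\\0&1\end{pmatrix}\oplus I_{n-3},\quad \widetilde{\beta_n}(t)(\alpha_i)=I_{i-2}\oplus\begin{pmatrix}1&0&0\\1&-1&1\\0&0&1\end{pmatrix}\oplus I_{n-i-2},\quad \widetilde{\beta_n}(t)(\alpha_{n-1})=I_{n-3}\oplus\begin{pmatrix}1&0\\1&-1\end{pmatrix},$$ and $\widehat{\beta_n}(t)(\sigma_j)=\beta_n(t)(\sigma_j)$ for all $j$ (the matrices above), with $$\widehat{\beta_n}(t)(\alpha_1)=\begin{pmatrix}-1&0\\ \frac1t&1\end{pmatrix}\oplus I_{n-3},\quad \widehat{\beta_n}(t)(\alpha_i)=I_{i-2}\oplus\begin{pmatrix}1&t&0\\0&-1&0\\0&\frac1t&1\end{pmatrix}\oplus I_{n-i-2},\quad \widehat{\beta_n}(t)(\alpha_{n-1})=I_{n-3}\oplus\begin{pmatrix}1&t\\0&-1\end{pmatrix}.$$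 For $z\in\mathbb{C}^*$, $\beta_n(z),\widetilde{\beta_n}(z),\widehat{\beta_n}(z)$ denote the maps obtained by the specialization $t\mapsto z$. *)

theory Defs
  imports
    "HOL-Algebra.Generated_Groups"
    "HOL-Library.Poly_Mapping"
    "Jordan_Normal_Form.VS_Connect"
begin

section \<open>Groups given by generators and relations\<close>

text \<open>A letter \<open>(s, True)\<close> stands for the generator \<open>s\<close>, and \<open>(s, False)\<close> for its inverse.\<close>

type_synonym 'a word = "('a \<times> bool) list"

definition words :: "'a set \<Rightarrow> 'a word set" where
  "words S = lists (S \<times> UNIV)"

text \<open>The congruence generated on the words over \<open>S\<close> by free cancellation and by the relations
  \<open>u = v\<close> with \<open>(u, v) \<in> R\<close>.\<close>

inductive_set pres_rel :: "'a set \<Rightarrow> ('a word \<times> 'a word) set \<Rightarrow> ('a word \<times> 'a word) set"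
  for S R where
  refl: "w \<in> words S \<Longrightarrow> (w, w) \<in> pres_rel S R"
| sym: "(v, w) \<in> pres_rel S R \<Longrightarrow> (w, v) \<in> pres_rel S R"
| trans: "(u, v) \<in> pres_rel S R \<Longrightarrow> (v, w) \<in> pres_rel S R \<Longrightarrow> (u, w) \<in> pres_rel S R"
| cancel: "x \<in> words S \<Longrightarrow> y \<in> words S \<Longrightarrow> s \<in> S \<Longrightarrow>
    (x @ [(s, b), (s, \<not> b)] @ y, x @ y) \<in> pres_rel S R"
| relation: "x \<in> words S \<Longrightarrow> y \<in> words S \<Longrightarrow> (u, v) \<in> R \<Longrightarrow>
    (x @ u @ y, x @ v @ y) \<in> pres_rel S R"

definition presented_group :: "'a set \<Rightarrow> ('a word \<times> 'a word) set \<Rightarrow> 'a word set monoid" where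
  "presented_group S R =
    \<lparr>carrier = words S // pres_rel S R,
     mult = (\<lambda>C D. \<Union>u\<in>C. \<Union>v\<in>D. pres_rel S R `` {u @ v}),
     one = pres_rel S R `` {[]}\<rparr>"

lemma words_simps [simp]:
  "[] \<in> words S"
  "u @ v \<in> words S \<longleftrightarrow> u \<in> words S \<and> v \<in> words S"
  "(s, b) # v \<in> words S \<longleftrightarrow> s \<in> S \<and> v \<in> words S"
  by (auto simp: words_def)

context
  fixes S :: "'a set" and R :: "('a word \<times> 'a word) set"
  assumes R: "R \<subseteq> words S \<times> words S"
begin

lemma pres_rel_words:
  assumes "(u, v) \<in> pres_rel S R"
  shows "u \<in> words S \<and> v \<in> words S"
  using assms by induction (use R in auto)

lemma equiv_pres_rel: "equiv (words S) (pres_rel S R)"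
proof (rule equivI)
  show "pres_rel S R \<subseteq> words S \<times> words S"
    using pres_rel_words by auto
  show "refl_on (words S) (pres_rel S R)"
    by (simp add: refl_on_def pres_rel.refl)
  show "sym (pres_rel S R)"
    by (rule symI) (rule pres_rel.sym)
  show "trans (pres_rel S R)"
    by (rule transI) (rule pres_rel.trans)
qed

lemma pres_rel_append_right:
  assumes "(u, v) \<in> pres_rel S R" "w \<in> words S"
  shows "(u @ w, v @ w) \<in> pres_rel S R"
  using assms
proof induction
  case (refl u) then show ?case by (simp add: pres_rel.refl)
next
  case (sym u v) show ?case by (rule pres_rel.sym) (rule sym.IH[OF sym.prems])
next
  case (trans t u v) show ?case by (rule pres_rel.trans) (rule trans.IH[OF trans.prems])+
next
  case (cancel x y s b)
  then show ?case using pres_rel.cancel[of x S "y @ w" s b R] by simp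
next
  case (relation x y u v)
  then show ?case using pres_rel.relation[of x S "y @ w" u v R] by simp
qed

lemma pres_rel_append_left:
  assumes "(u, v) \<in> pres_rel S R" "w \<in> words S"
  shows "(w @ u, w @ v) \<in> pres_rel S R"
  using assms
proof induction
  case (refl u) then show ?case by (simp add: pres_rel.refl)
next
  case (sym u v) show ?case by (rule pres_rel.sym) (rule sym.IH[OF sym.prems])
next
  case (trans t u v) show ?case by (rule pres_rel.trans) (rule trans.IH[OF trans.prems])+
next
  case (cancel x y s b)
  then show ?case using pres_rel.cancel[of "w @ x" S y s b R] by simp
next
  case (relation x y u v)
  then show ?case using pres_rel.relation[of "w @ x" S y u v R] by simp
qed

lemma pres_rel_append:
  assumes "(u, u') \<in> pres_rel S R" "(v, v') \<in> pres_rel S R"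
  shows "(u @ v, u' @ v') \<in> pres_rel S R"
proof (rule pres_rel.trans)
  show "(u @ v, u' @ v) \<in> pres_rel S R"
    using pres_rel_words[OF assms(2)] by (intro pres_rel_append_right assms) simp
  show "(u' @ v, u' @ v') \<in> pres_rel S R"
    using pres_rel_words[OF assms(1)] by (intro pres_rel_append_left assms) simp
qed

lemma presented_group_mult_class:
  assumes "u \<in> words S" "v \<in> words S"
  shows "pres_rel S R `` {u} \<otimes>\<^bsub>presented_group S R\<^esub> pres_rel S R `` {v} = pres_rel S R `` {u @ v}"
proof -
  have *: "pres_rel S R `` {a @ b} = pres_rel S R `` {u @ v}"
    if "(u, a) \<in> pres_rel S R" "(v, b) \<in> pres_rel S R" for a b
    using equiv_class_eq[OF equiv_pres_rel pres_rel_append[OF that]] by simp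
  have "u \<in> pres_rel S R `` {u}" "v \<in> pres_rel S R `` {v}"
    using assms by (simp_all add: pres_rel.refl)
  then have "(\<Union>a\<in>pres_rel S R `` {u}. \<Union>b\<in>pres_rel S R `` {v}. pres_rel S R `` {a @ b})
      = (\<Union>a\<in>pres_rel S R `` {u}. \<Union>b\<in>pres_rel S R `` {v}. pres_rel S R `` {u @ v})"
    by (intro SUP_cong HOL.refl *) auto
  also have "\<dots> = pres_rel S R `` {u @ v}"
    using \<open>u \<in> pres_rel S R `` {u}\<close> \<open>v \<in> pres_rel S R `` {v}\<close> by blast
  finally show ?thesis
    by (simp add: presented_group_def)
qed

lemma pres_rel_inverse:
  assumes "w \<in> words S"
  shows "\<exists>v \<in> words S. (v @ w, []) \<in> pres_rel S R"
  using assms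
proof (induction w)
  case Nil
  show ?case using pres_rel.refl[of "[]" S R] by (intro bexI[of _ "[]"]) auto
next
  case (Cons a w)
  obtain s b where a: "a = (s, b)" by (cases a)
  from Cons a obtain v where v: "v \<in> words S" "(v @ w, []) \<in> pres_rel S R"
    by auto
  have "(v @ [(s, \<not> b), (s, \<not> \<not> b)] @ w, v @ w) \<in> pres_rel S R"
    using Cons.prems a v by (intro pres_rel.cancel) auto
  from pres_rel.trans[OF this v(2)] have "((v @ [(s, \<not> b)]) @ a # w, []) \<in> pres_rel S R"
    by (simp add: a)
  then show ?case
    using v Cons.prems a by (intro bexI[of _ "v @ [(s, \<not> b)]"]) auto
qed

lemma group_presented_group: "group (presented_group S R)"
proof (rule groupI)
  let ?G = "presented_group S R" and ?c = "\<lambda>w. pres_rel S R `` {w}"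
  have carr: "C \<in> carrier ?G \<longleftrightarrow> (\<exists>w \<in> words S. C = ?c w)" for C
    by (auto simp: presented_group_def quotient_def)
  have one: "\<one>\<^bsub>?G\<^esub> = ?c []"
    by (simp add: presented_group_def)
  note mult = presented_group_mult_class
  show "C \<otimes>\<^bsub>?G\<^esub> D \<in> carrier ?G" if "C \<in> carrier ?G" "D \<in> carrier ?G" for C D
    using that by (force simp: carr mult)
  show "\<one>\<^bsub>?G\<^esub> \<in> carrier ?G"
    by (auto simp: carr one)
  show "C \<otimes>\<^bsub>?G\<^esub> D \<otimes>\<^bsub>?G\<^esub> E = C \<otimes>\<^bsub>?G\<^esub> (D \<otimes>\<^bsub>?G\<^esub> E)"
    if "C \<in> carrier ?G" "D \<in> carrier ?G" "E \<in> carrier ?G" for C D E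
    using that by (auto simp: carr mult)
  show "\<one>\<^bsub>?G\<^esub> \<otimes>\<^bsub>?G\<^esub> C = C" if "C \<in> carrier ?G" for C
    using that by (auto simp: carr one mult)
  show "\<exists>D \<in> carrier ?G. D \<otimes>\<^bsub>?G\<^esub> C = \<one>\<^bsub>?G\<^esub>" if "C \<in> carrier ?G" for C
  proof -
    from that obtain w where w: "w \<in> words S" "C = ?c w" by (auto simp: carr)
    obtain v where v: "v \<in> words S" "(v @ w, []) \<in> pres_rel S R"
      using pres_rel_inverse[OF w(1)] by blast
    have "?c v \<otimes>\<^bsub>?G\<^esub> C = \<one>\<^bsub>?G\<^esub>"
      using equiv_class_eq[OF equiv_pres_rel v(2)] v w by (simp add: mult one)
    moreover have "?c v \<in> carrier ?G" using v by (auto simp: carr)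
    ultimately show ?thesis by (rule bexI)
  qed
qed

end

text \<open>The value of a word in a group \<open>H\<close> once the generators are sent to elements of \<open>H\<close> by \<open>f\<close>.\<close>

definition word_value :: "('h, 'm) monoid_scheme \<Rightarrow> ('a \<Rightarrow> 'h) \<Rightarrow> 'a word \<Rightarrow> 'h" where
  "word_value H f w =
    foldr (\<lambda>(s, b) h. (if b then f s else inv\<^bsub>H\<^esub> f s) \<otimes>\<^bsub>H\<^esub> h) w \<one>\<^bsub>H\<^esub>"

text \<open>The map to \<open>H\<close> determined by the images \<open>f\<close> of the generators in \<open>S\<close>: a group element \<open>C\<close> (a class
  of words) is sent to the common value of the words over \<open>S\<close> representing it. It is only meaningful
  if this value does not depend on the representing word; for \<open>S\<close> smaller than the whole
  generating set, the map lives on the subgroup generated by \<open>S\<close>.\<close>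

definition map_on_gens ::
    "('h, 'm) monoid_scheme \<Rightarrow> 'a set \<Rightarrow> ('a \<Rightarrow> 'h) \<Rightarrow> 'a word set \<Rightarrow> 'h" where
  "map_on_gens H S f C = the_elem (word_value H f ` (C \<inter> words S))"


section \<open>The welded braid group and its braid subgroup\<close>

datatype wb_gen = Alpha nat | Sigma nat

definition wb_gens :: "nat \<Rightarrow> wb_gen set" where
  "wb_gens n = Alpha ` {1..n-1} \<union> Sigma ` {1..n-1}"

definition pos_word :: "'a list \<Rightarrow> 'a word" where
  "pos_word = map (\<lambda>s. (s, True))"

definition wb_relations :: "nat \<Rightarrow> (wb_gen list \<times> wb_gen list) set" where
  "wb_relations n =
    {([Alpha i, Alpha i], []) | i. i \<in> {1..n-1}}
  \<union> {([Alpha i, Alpha j], [Alpha j, Alpha i]) | i j.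
        i \<in> {1..n-1} \<and> j \<in> {1..n-1} \<and> \<bar>int i - int j\<bar> \<ge> 2}
  \<union> {([Sigma i, Sigma j], [Sigma j, Sigma i]) | i j.
        i \<in> {1..n-1} \<and> j \<in> {1..n-1} \<and> \<bar>int i - int j\<bar> \<ge> 2}
  \<union> {([Alpha i, Sigma j], [Sigma j, Alpha i]) | i j.
        i \<in> {1..n-1} \<and> j \<in> {1..n-1} \<and> \<bar>int i - int j\<bar> \<ge> 2}
  \<union> {([Alpha i, Alpha (i+1), Alpha i], [Alpha (i+1), Alpha i, Alpha (i+1)]) | i. i \<in> {1..n-2}}
  \<union> {([Sigma i, Sigma (i+1), Sigma i], [Sigma (i+1), Sigma i, Sigma (i+1)]) | i. i \<in> {1..n-2}}
  \<union> {([Alpha i, Alpha (i+1), Sigma i], [Sigma (i+1), Alpha i, Alpha (i+1)]) | i. i \<in> {1..n-2}}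
  \<union> {([Sigma i, Sigma (i+1), Alpha i], [Alpha (i+1), Sigma i, Sigma (i+1)]) | i. i \<in> {1..n-2}}"

definition wb_rel_words :: "nat \<Rightarrow> (wb_gen word \<times> wb_gen word) set" where
  "wb_rel_words n = map_prod pos_word pos_word ` wb_relations n"

definition WB :: "nat \<Rightarrow> wb_gen word set monoid" where
  "WB n = presented_group (wb_gens n) (wb_rel_words n)"

definition wb_elem :: "nat \<Rightarrow> wb_gen \<Rightarrow> wb_gen word set" where
  "wb_elem n s = pres_rel (wb_gens n) (wb_rel_words n) `` {[(s, True)]}"

definition sigma_gens :: "nat \<Rightarrow> wb_gen set" where
  "sigma_gens n = Sigma ` {1..n-1}"

definition braid_group :: "nat \<Rightarrow> wb_gen word set monoid" where
  "braid_group n = (WB n)\<lparr>carrier := generate (WB n) (wb_elem n ` sigma_gens n)\<rparr>"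

lemma group_WB: "group (WB n)"
proof -
  have "wb_rel_words n \<subseteq> words (wb_gens n) \<times> words (wb_gens n)"
    by (auto simp: wb_rel_words_def wb_relations_def pos_word_def wb_gens_def)
  then show ?thesis
    unfolding WB_def by (rule group_presented_group)
qed

lemma wb_elem_closed:
  assumes "s \<in> wb_gens n"
  shows "wb_elem n s \<in> carrier (WB n)"
  using assms by (auto simp: wb_elem_def WB_def presented_group_def intro: quotientI)

lemma group_braid_group: "group (braid_group n)"
proof -
  have "wb_elem n ` sigma_gens n \<subseteq> carrier (WB n)"
    using wb_elem_closed by (auto simp: sigma_gens_def wb_gens_def)
  then show ?thesis
    unfolding braid_group_def
    by (intro subgroup.subgroup_is_group group.generate_is_subgroup group_WB)
qed


section \<open>Matrix representations\<close>

definition GL :: "nat \<Rightarrow> 'a :: comm_ring_1 mat monoid" where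
  "GL m = units_of (ring_mat TYPE('a) m ())"

definition matrix_rep ::
    "('g, 'b) monoid_scheme \<Rightarrow> nat \<Rightarrow> ('g \<Rightarrow> 'a :: comm_ring_1 mat) \<Rightarrow> bool" where
  "matrix_rep G m \<rho> \<longleftrightarrow> \<rho> \<in> hom G (GL m)"

definition equivalent_reps ::
    "('g, 'b) monoid_scheme \<Rightarrow> nat \<Rightarrow> ('g \<Rightarrow> complex mat) \<Rightarrow> ('g \<Rightarrow> complex mat) \<Rightarrow> bool" where
  "equivalent_reps G m \<rho>\<^sub>1 \<rho>\<^sub>2 \<longleftrightarrow>
    (\<exists>X \<in> carrier (GL m). \<forall>g \<in> carrier G. X * \<rho>\<^sub>1 g = \<rho>\<^sub>2 g * X)"

definition irreducible_rep ::
    "('g, 'b) monoid_scheme \<Rightarrow> nat \<Rightarrow> ('g \<Rightarrow> complex mat) \<Rightarrow> bool" where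
  "irreducible_rep G m \<rho> \<longleftrightarrow> matrix_rep G m \<rho> \<and> m > 0 \<and>
    (\<forall>W. VectorSpace.subspace class_ring W (module_vec TYPE(complex) m) \<and>
         (\<forall>g \<in> carrier G. \<forall>w \<in> W. \<rho> g *\<^sub>v w \<in> W) \<longrightarrow>
       W = {0\<^sub>v m} \<or> W = carrier_vec m)"


section \<open>Laurent polynomials and specialization\<close>

text \<open>The ring of complex Laurent polynomials is the monoid algebra of the additive group of the
  integers, with \<open>p\<close> standing for the sum of \<open>lookup p k * t ^ k\<close>.\<close>

type_synonym laurent = "int \<Rightarrow>\<^sub>0 complex"

definition tvar :: laurent where
  "tvar = Poly_Mapping.single 1 1"

definition tvar_inv :: laurent where
  "tvar_inv = Poly_Mapping.single (-1) 1"

lemma tvar_mult_tvar_inv: "tvar * tvar_inv = 1"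
  by (simp add: tvar_def tvar_inv_def mult_single)

definition laurent_eval :: "complex \<Rightarrow> laurent \<Rightarrow> complex" where
  "laurent_eval z p = (\<Sum>k \<in> Poly_Mapping.keys p. Poly_Mapping.lookup p k * z powi k)"

definition specialize :: "complex \<Rightarrow> ('g \<Rightarrow> laurent mat) \<Rightarrow> 'g \<Rightarrow> complex mat" where
  "specialize z \<rho> g = map_mat (laurent_eval z) (\<rho> g)"


section \<open>The reduced Burau representation and its two extensions\<close>

text \<open>The common shape of the images of the \<open>i\<close>-th generators: \<open>A\<close> for \<open>i = 1\<close>, \<open>C\<close> for \<open>i = n - 1\<close>
  and \<open>B\<close> for the indices in between.\<close>

definition burau_shape ::
    "nat \<Rightarrow> 'a :: comm_ring_1 list list \<Rightarrow> 'a list list \<Rightarrow> 'a list list \<Rightarrow> nat \<Rightarrow> 'a mat" where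
  "burau_shape n A B C i =
    (if i = 1 then diag_block_mat [mat_of_rows_list 2 A, 1\<^sub>m (n - 3)]
     else if i = n - 1 then diag_block_mat [1\<^sub>m (n - 3), mat_of_rows_list 2 C]
     else diag_block_mat [1\<^sub>m (i - 2), mat_of_rows_list 3 B, 1\<^sub>m (n - i - 2)])"

definition burau_sigma :: "nat \<Rightarrow> nat \<Rightarrow> laurent mat" where
  "burau_sigma n = burau_shape n
    [[-tvar, 0],
     [1, 1]]
    [[1, tvar, 0],
     [0, -tvar, 0],
     [0, 1, 1]]
    [[1, tvar],
     [0, -tvar]]"

definition tilde_sigma :: "nat \<Rightarrow> nat \<Rightarrow> laurent mat" where
  "tilde_sigma n = burau_shape n
    [[-tvar, 1],
     [0, 1]]
    [[1, 0, 0],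
     [tvar, -tvar, 1],
     [0, 0, 1]]
    [[1, 0],
     [tvar, -tvar]]"

definition tilde_alpha :: "nat \<Rightarrow> nat \<Rightarrow> laurent mat" where
  "tilde_alpha n = burau_shape n
    [[-1, 1],
     [0, 1]]
    [[1, 0, 0],
     [1, -1, 1],
     [0, 0, 1]]
    [[1, 0],
     [1, -1]]"

definition hat_alpha :: "nat \<Rightarrow> nat \<Rightarrow> laurent mat" where
  "hat_alpha n = burau_shape n
    [[-1, 0],
     [tvar_inv, 1]]
    [[1, tvar, 0],
     [0, -1, 0],
     [0, tvar_inv, 1]]
    [[1, tvar],
     [0, -1]]"

text \<open>Only words in the \<open>Sigma i\<close> are evaluated here, so no image of \<open>Alpha i\<close> is given.\<close>

definition burau :: "nat \<Rightarrow> wb_gen word set \<Rightarrow> laurent mat" where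
  "burau n = map_on_gens (GL (n - 1)) (sigma_gens n)
    (\<lambda>s. case s of Sigma i \<Rightarrow> burau_sigma n i)"

definition tilde_burau :: "nat \<Rightarrow> wb_gen word set \<Rightarrow> laurent mat" where
  "tilde_burau n = map_on_gens (GL (n - 1)) (wb_gens n)
    (\<lambda>s. case s of Alpha i \<Rightarrow> tilde_alpha n i | Sigma i \<Rightarrow> tilde_sigma n i)"

definition hat_burau :: "nat \<Rightarrow> wb_gen word set \<Rightarrow> laurent mat" where
  "hat_burau n = map_on_gens (GL (n - 1)) (wb_gens n)
    (\<lambda>s. case s of Alpha i \<Rightarrow> hat_alpha n i | Sigma i \<Rightarrow> burau_sigma n i)"

abbreviation burau_at :: "nat \<Rightarrow> complex \<Rightarrow> wb_gen word set \<Rightarrow> complex mat" where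
  "burau_at n z \<equiv> specialize z (burau n)"

abbreviation tilde_burau_at :: "nat \<Rightarrow> complex \<Rightarrow> wb_gen word set \<Rightarrow> complex mat" where
  "tilde_burau_at n z \<equiv> specialize z (tilde_burau n)"

abbreviation hat_burau_at :: "nat \<Rightarrow> complex \<Rightarrow> wb_gen word set \<Rightarrow> complex mat" where
  "hat_burau_at n z \<equiv> specialize z (hat_burau n)"

definition P_poly :: "nat \<Rightarrow> complex \<Rightarrow> complex" where
  "P_poly n z = (\<Sum>k<n. z ^ k)"

end

theory Submission
  imports Defs
begin

text \<open>Put \<open>m = n - 1\<close> and view a vector of length \<open>m\<close> as a sequence \<open>x\<^sub>0, \<dots>, x\<^sub>n\<close> with \<open>x\<^sub>0 = x\<^sub>n = 0\<close>. In the
  extension written with a tilde, a generator of index \<open>i\<close> replaces \<open>x\<^sub>i\<close> by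
  \<open>a x\<^sub>i\<^sub>-\<^sub>1 + b x\<^sub>i + c x\<^sub>i\<^sub>+\<^sub>1\<close>, with coefficients \<open>(t, -t, 1)\<close> for \<open>\<sigma>\<^sub>i\<close> and \<open>(1, -1, 1)\<close> for \<open>\<alpha>\<^sub>i\<close>.
  In the extension written with a hat, the matrices are the transposes of such replacements, with
  coefficients \<open>(t, -t, 1)\<close> for \<open>\<sigma>\<^sub>i\<close> and \<open>(t, -1, 1/t)\<close> for \<open>\<alpha>\<^sub>i\<close>. The defining relations thus become
  identities between local replacements (\<open>node_op_slide_up\<close>, and \<open>node_op_slide_down\<close> for the
  transposes, which reverse products), and the universal property of the presentation
  (\<open>map_on_gens_hom\<close>) gives both representations. Specialization is a ring homomorphism, which carries
  them over to complex matrices.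

  On the braid group the two extensions are transposes of each other on generators. A symmetric
  tridiagonal matrix \<open>X\<close> (\<open>burau_form\<close>), whose \<open>i\<close>-th column spans the image of \<open>\<sigma>\<^sub>i - 1\<close> in the Burau
  representation, intertwines them (\<open>burau_form_intertwines\<close>). A vector in its kernel satisfies
  \<open>x\<^sub>i\<^sub>+\<^sub>1 - x\<^sub>i = z (x\<^sub>i - x\<^sub>i\<^sub>-\<^sub>1)\<close>, so it is a multiple of the sequence \<open>P\<^sub>k(z)\<close>; as its last term must be \<open>0\<close>,
  the matrix is invertible if \<open>P\<^sub>n(z) \<noteq> 0\<close> (\<open>burau_form_GL\<close>). The same matrix gives irreducibility: an
  invariant subspace containing a nonzero vector contains one column of \<open>X\<close>, then the neighbouring
  columns, and so all of them (\<open>burau_form_invariant_subspace\<close>).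

  The inequivalences are read off characters. The trace of \<open>\<sigma>\<^sub>1\<close> is \<open>n - 2 - z\<close> in both extensions, which
  separates different values of \<open>z\<close>; the trace of \<open>\<sigma>\<^sub>1 \<alpha>\<^sub>2\<close> is \<open>n - 3 - z\<close> in one extension and
  \<open>n - 4\<close> in the other, which separates the extensions unless \<open>z = 1\<close>. For \<open>z = 1\<close> the matrices of
  \<open>\<alpha>\<^sub>i\<close> and \<open>\<sigma>\<^sub>i\<close> coincide, so \<open>X\<close> is an intertwiner for the whole welded braid group.\<close>

section \<open>Homomorphisms out of a presented group\<close>

lemma word_value_Nil [simp]: "word_value H f [] = \<one>\<^bsub>H\<^esub>"
  by (simp add: word_value_def)

lemma word_value_Cons [simp]:
  "word_value H f ((s, b) # w) = (if b then f s else inv\<^bsub>H\<^esub> f s) \<otimes>\<^bsub>H\<^esub> word_value H f w"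
  by (simp add: word_value_def)

lemma word_value_cong:
  assumes "\<And>s. s \<in> S \<Longrightarrow> f s = g s" "w \<in> words S"
  shows "word_value H f w = word_value H g w"
  using assms(2)
proof (induction w)
  case (Cons a w)
  then show ?case using assms(1) by (cases a) auto
qed simp

lemma map_on_gens_cong:
  assumes "\<And>s. s \<in> S \<Longrightarrow> f s = g s"
  shows "map_on_gens H S f = map_on_gens H S g"
proof
  fix C
  have "word_value H f ` (C \<inter> words S) = word_value H g ` (C \<inter> words S)"
    by (intro image_cong HOL.refl word_value_cong[OF assms]) auto
  then show "map_on_gens H S f C = map_on_gens H S g C"
    by (simp add: map_on_gens_def)
qed

lemma words_mono: "T \<subseteq> S \<Longrightarrow> words T \<subseteq> words S"
  unfolding words_def by (intro lists_mono) auto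

context group
begin

lemma word_value_closed:
  assumes "f \<in> S \<rightarrow> carrier G" "w \<in> words S"
  shows "word_value G f w \<in> carrier G"
  using assms(2)
proof (induction w)
  case (Cons a w)
  then show ?case using assms(1) by (cases a) (auto simp: Pi_iff)
qed simp

lemma word_value_append:
  assumes "f \<in> S \<rightarrow> carrier G" "u \<in> words S" "v \<in> words S"
  shows "word_value G f (u @ v) = word_value G f u \<otimes> word_value G f v"
  using assms(2)
proof (induction u)
  case Nil
  then show ?case using word_value_closed[OF assms(1,3)] by simp
next
  case (Cons a u)
  obtain s b where a: "a = (s, b)" by (cases a)
  then have "f s \<in> carrier G" "u \<in> words S"
    using Cons.prems assms(1) by auto
  then show ?case
    using Cons.IH word_value_closed[OF assms(1)] assms(3) by (simp add: a m_assoc)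
qed

text \<open>Free cancellation is respected in every group, so only the relations have to be checked:
  this is the universal property of a presentation.\<close>

lemma word_value_pres_rel:
  assumes f: "f \<in> S \<rightarrow> carrier G" and R: "R \<subseteq> words S \<times> words S"
    and rel: "\<And>u v. (u, v) \<in> R \<Longrightarrow> word_value G f u = word_value G f v"
    and "(u, v) \<in> pres_rel S R"
  shows "word_value G f u = word_value G f v"
  using assms(4)
proof induction
  case (cancel x y s b)
  have "f s \<in> carrier G" "word_value G f y \<in> carrier G"
    using f cancel word_value_closed[OF f] by auto
  then have "word_value G f ([(s, b), (s, \<not> b)] @ y) = word_value G f y"
    by (cases b) (simp_all add: m_assoc[symmetric])
  then show ?case
    using cancel word_value_append[OF f, of x "[(s, b), (s, \<not> b)] @ y"]
      word_value_append[OF f, of x y] by simp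
next
  case (relation x y u v)
  then have "u \<in> words S" "v \<in> words S" using R by auto
  then show ?case
    using relation rel[OF relation(3)] by (simp add: word_value_append[OF f])
qed auto

text \<open>Taking \<open>T\<close> smaller than \<open>S\<close> evaluates the restriction of the homomorphism to the subgroup
  generated by \<open>T\<close>, since it only looks at those representatives that are words over \<open>T\<close>.\<close>

lemma map_on_gens_class:
  assumes f: "f \<in> S \<rightarrow> carrier G" and R: "R \<subseteq> words S \<times> words S"
    and rel: "\<And>u v. (u, v) \<in> R \<Longrightarrow> word_value G f u = word_value G f v"
    and T: "T \<subseteq> S" and w: "w \<in> words T"
  shows "map_on_gens G T f (pres_rel S R `` {w}) = word_value G f w"
proof -
  let ?C = "pres_rel S R `` {w} \<inter> words T"
  have "w \<in> ?C"
    using w words_mono[OF T] by (auto intro: pres_rel.refl)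
  moreover have "word_value G f v = word_value G f w" if "v \<in> ?C" for v
    using that word_value_pres_rel[OF f R rel, of w v] by simp
  ultimately have "word_value G f ` ?C = {word_value G f w}"
    by blast
  then show ?thesis
    by (simp add: map_on_gens_def)
qed

lemma map_on_gens_hom:
  assumes f: "f \<in> S \<rightarrow> carrier G" and R: "R \<subseteq> words S \<times> words S"
    and rel: "\<And>u v. (u, v) \<in> R \<Longrightarrow> word_value G f u = word_value G f v"
  shows "map_on_gens G S f \<in> hom (presented_group S R) G"
proof (rule homI)
  note eval = map_on_gens_class[OF f R rel subset_refl]
  have carr: "\<exists>w \<in> words S. C = pres_rel S R `` {w}" if "C \<in> carrier (presented_group S R)" for C
    using that by (auto simp: presented_group_def quotient_def)
  fix C D
  assume C: "C \<in> carrier (presented_group S R)"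
  obtain u where u: "u \<in> words S" "C = pres_rel S R `` {u}"
    using carr[OF C] by auto
  show "map_on_gens G S f C \<in> carrier G"
    using u eval word_value_closed[OF f] by simp
  assume D: "D \<in> carrier (presented_group S R)"
  obtain v where v: "v \<in> words S" "D = pres_rel S R `` {v}"
    using carr[OF D] by auto
  show "map_on_gens G S f (C \<otimes>\<^bsub>presented_group S R\<^esub> D)
      = map_on_gens G S f C \<otimes> map_on_gens G S f D"
    using u v eval word_value_append[OF f]
    by (simp add: presented_group_mult_class[OF R])
qed

end

text \<open>For a proper subset \<open>T\<close> this provides the representatives on which a map on the generated subgroup,
  such as the Burau representation of the braid group, is evaluated. For \<open>T = S\<close> it allows induction
  over the generators of the whole group.\<close>

lemma generate_presented_group:
  assumes R: "R \<subseteq> words S \<times> words S" and T: "T \<subseteq> S"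
  shows "generate (presented_group S R) ((\<lambda>s. pres_rel S R `` {[(s, True)]}) ` T)
    = (\<lambda>w. pres_rel S R `` {w}) ` words T"
    (is "generate ?G (?e ` T) = ?c ` words T")
proof -
  interpret group ?G by (rule group_presented_group[OF R])
  note mult = presented_group_mult_class[OF R]
  have TS: "w \<in> words S" if "w \<in> words T" for w
    using words_mono[OF T] that by auto
  have one: "\<one>\<^bsub>?G\<^esub> = ?c []"
    by (simp add: presented_group_def)
  have carr: "?c w \<in> carrier ?G" if "w \<in> words S" for w
    using that by (auto simp: presented_group_def intro: quotientI)
  have inv: "inv\<^bsub>?G\<^esub> (?c [(s, True)]) = ?c [(s, False)]" if "s \<in> S" for s
  proof (rule inv_equality)
    have "([] @ [(s, False), (s, \<not> False)] @ [], [] @ []) \<in> pres_rel S R"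
      using that by (intro pres_rel.cancel) auto
    then have "?c [(s, False), (s, True)] = ?c []"
      using equiv_class_eq[OF equiv_pres_rel[OF R]] by simp
    then show "?c [(s, False)] \<otimes>\<^bsub>?G\<^esub> ?c [(s, True)] = \<one>\<^bsub>?G\<^esub>"
      using that by (simp add: mult one)
  qed (use that in \<open>auto intro!: carr\<close>)
  show ?thesis
  proof (intro equalityI subsetI)
    fix g assume "g \<in> generate ?G (?e ` T)"
    then show "g \<in> ?c ` words T"
    proof induction
      case one
      show ?case unfolding \<open>\<one>\<^bsub>?G\<^esub> = ?c []\<close> by (rule imageI) simp
    next
      case (incl h)
      then show ?case by auto
    next
      case (inv h)
      then obtain s where s: "s \<in> T" "h = ?e s" by auto
      then have "inv\<^bsub>?G\<^esub> h = ?c [(s, False)]"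
        using T \<open>\<And>s. s \<in> S \<Longrightarrow> inv\<^bsub>?G\<^esub> (?c [(s, True)]) = ?c [(s, False)]\<close> by auto
      moreover have "[(s, False)] \<in> words T" using s by simp
      ultimately show ?case by blast
    next
      case (eng g h)
      then obtain u v where "u \<in> words T" "v \<in> words T" "g = ?c u" "h = ?c v" by auto
      then have "g \<otimes>\<^bsub>?G\<^esub> h = ?c (u @ v)" "u @ v \<in> words T"
        by (simp_all add: mult TS)
      then show ?case by blast
    qed
  next
    fix g assume "g \<in> ?c ` words T"
    then obtain w where w: "w \<in> words T" "g = ?c w" by auto
    from w(1) have "?c w \<in> generate ?G (?e ` T)"
    proof (induction w)
      case Nil
      then show ?case using generate.one[of ?G "?e ` T"] by (simp add: one)
    next
      case (Cons a w)
      obtain s b where a: "a = (s, b)" by (cases a)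
      have s: "s \<in> T" "s \<in> S" and w: "w \<in> words T"
        using Cons.prems T by (auto simp: a)
      have "?c [(s, b)] \<in> generate ?G (?e ` T)"
        using s inv[OF s(2)] generate.incl[of "?e s" "?e ` T" ?G]
          generate.inv[of "?e s" "?e ` T" ?G] by (cases b) auto
      then have "?c [(s, b)] \<otimes>\<^bsub>?G\<^esub> ?c w \<in> generate ?G (?e ` T)"
        using Cons.IH w by (intro generate.eng) auto
      then show ?case
        using s TS[OF w] by (simp add: mult a)
    qed
    then show "g \<in> generate ?G (?e ` T)" using w by simp
  qed
qed

lemma wb_rel_words_subset: "wb_rel_words n \<subseteq> words (wb_gens n) \<times> words (wb_gens n)"
  by (auto simp: wb_rel_words_def wb_relations_def pos_word_def wb_gens_def)

lemma sigma_gens_subset: "sigma_gens n \<subseteq> wb_gens n"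
  by (auto simp: sigma_gens_def wb_gens_def)

lemma carrier_WB_eq_generate: "carrier (WB n) = generate (WB n) (wb_elem n ` wb_gens n)"
proof -
  have "carrier (WB n) = (\<lambda>w. pres_rel (wb_gens n) (wb_rel_words n) `` {w}) ` words (wb_gens n)"
    by (auto simp: WB_def presented_group_def quotient_def)
  then show ?thesis
    using generate_presented_group[OF wb_rel_words_subset subset_refl, of n]
    by (simp add: WB_def wb_elem_def[abs_def])
qed

lemma carrier_braid_group_eq:
  "carrier (braid_group n)
    = (\<lambda>w. pres_rel (wb_gens n) (wb_rel_words n) `` {w}) ` words (sigma_gens n)"
  using generate_presented_group[OF wb_rel_words_subset sigma_gens_subset, of n]
  by (simp add: braid_group_def WB_def wb_elem_def[abs_def])

lemma carrier_braid_group_subset: "carrier (braid_group n) \<subseteq> carrier (WB n)"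
  using words_mono[OF sigma_gens_subset, of n]
  by (auto simp: carrier_braid_group_eq WB_def presented_group_def intro!: quotientI)


section \<open>Matrix groups, intertwiners and characters\<close>

lemma GL_simps:
  "x \<otimes>\<^bsub>GL m\<^esub> y = x * y" "\<one>\<^bsub>GL m\<^esub> = 1\<^sub>m m"
  by (simp_all add: GL_def units_of_def ring_mat_simps)

lemma carrier_GL:
  "A \<in> carrier (GL m) \<longleftrightarrow>
    A \<in> carrier_mat m m \<and> (\<exists>B \<in> carrier_mat m m. B * A = 1\<^sub>m m \<and> A * B = 1\<^sub>m m)"
  by (auto simp: GL_def units_of_def Units_def ring_mat_simps)

lemma group_GL: "group (GL m :: 'a :: comm_ring_1 mat monoid)"
proof -
  interpret ring "ring_mat TYPE('a) m ()" by (rule ring_mat)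
  show ?thesis unfolding GL_def by (rule units_group)
qed

lemma GL_carrier_mat: "A \<in> carrier (GL m) \<Longrightarrow> A \<in> carrier_mat m m"
  by (simp add: carrier_GL)

lemma GL_transpose: "A \<in> carrier (GL m) \<Longrightarrow> transpose_mat A \<in> carrier (GL m)"
  unfolding carrier_GL
  by (metis transpose_carrier_mat transpose_mult transpose_one)

lemma GL_if_det_nonzero:
  assumes "A \<in> carrier_mat m m" "det A \<noteq> (0 :: 'a :: field)"
  shows "A \<in> carrier (GL m)"
  using det_non_zero_imp_unit[OF assms, of "()"] by (simp add: GL_def units_of_def)

lemma hom_map_mat_GL:
  assumes "semiring_hom h"
  shows "map_mat h \<in> hom (GL m) (GL m)"
proof -
  interpret semiring_hom h by fact
  show ?thesis
  proof (rule homI)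
    fix A :: "'a mat" assume "A \<in> carrier (GL m)"
    then obtain B where "A \<in> carrier_mat m m" "B \<in> carrier_mat m m" "B * A = 1\<^sub>m m" "A * B = 1\<^sub>m m"
      by (auto simp: carrier_GL)
    then show "map_mat h A \<in> carrier (GL m)"
      unfolding carrier_GL
      using mat_hom_mult[of A m m B m] mat_hom_mult[of B m m A m]
      by (auto simp: mat_hom_one intro!: bexI[of _ "map_mat h B"])
  qed (auto simp: GL_simps dest!: GL_carrier_mat intro: mat_hom_mult)
qed

text \<open>An intertwiner need only be checked on generators, because the elements on which \<open>X\<close>
  intertwines are closed under products and inverses.\<close>

lemma intertwines_generate:
  assumes G: "group G"
    and \<rho>1: "\<rho>\<^sub>1 \<in> hom G (GL m)" and \<rho>2: "\<rho>\<^sub>2 \<in> hom G (GL m)"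
    and X: "X \<in> carrier_mat m m" and A: "A \<subseteq> carrier G"
    and int: "\<And>s. s \<in> A \<Longrightarrow> X * \<rho>\<^sub>1 s = \<rho>\<^sub>2 s * X"
    and g: "g \<in> generate G A"
  shows "X * \<rho>\<^sub>1 g = \<rho>\<^sub>2 g * X"
proof -
  interpret group G by fact
  interpret \<rho>1: group_hom G "GL m" \<rho>\<^sub>1
    using \<rho>1 by (intro group_hom.intro group_hom_axioms.intro G group_GL)
  interpret \<rho>2: group_hom G "GL m" \<rho>\<^sub>2
    using \<rho>2 by (intro group_hom.intro group_hom_axioms.intro G group_GL)
  have c1 [simp]: "\<rho>\<^sub>1 h \<in> carrier_mat m m" if "h \<in> carrier G" for h
    using \<rho>1.hom_closed[OF that] by (rule GL_carrier_mat)
  have c2 [simp]: "\<rho>\<^sub>2 h \<in> carrier_mat m m" if "h \<in> carrier G" for h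
    using \<rho>2.hom_closed[OF that] by (rule GL_carrier_mat)
  note assoc = assoc_mult_mat[of _ m m _ m _ m] mult_carrier_mat[of _ m m _ m]
  from g show ?thesis
  proof induction
    case one
    show ?case using X by (simp add: GL_simps)
  next
    case (incl h)
    then show ?case by (rule int)
  next
    case (inv h)
    define k where "k = inv\<^bsub>G\<^esub> h"
    have h: "h \<in> carrier G" and k: "k \<in> carrier G"
      using inv A by (auto simp: k_def)
    have hk: "h \<otimes>\<^bsub>G\<^esub> k = \<one>\<^bsub>G\<^esub>" "k \<otimes>\<^bsub>G\<^esub> h = \<one>\<^bsub>G\<^esub>"
      using h by (auto simp: k_def)
    have i1: "\<rho>\<^sub>1 h * \<rho>\<^sub>1 k = 1\<^sub>m m"
      using \<rho>1.hom_mult[OF h k] by (simp add: hk GL_simps)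
    have i2: "\<rho>\<^sub>2 k * \<rho>\<^sub>2 h = 1\<^sub>m m"
      using \<rho>2.hom_mult[OF k h] by (simp add: hk GL_simps)
    have "X * \<rho>\<^sub>1 k = (\<rho>\<^sub>2 k * \<rho>\<^sub>2 h) * X * \<rho>\<^sub>1 k"
      using X h k by (simp add: i2)
    also have "\<dots> = \<rho>\<^sub>2 k * (\<rho>\<^sub>2 h * X) * \<rho>\<^sub>1 k"
      using X h k by (simp add: assoc)
    also have "\<rho>\<^sub>2 h * X = X * \<rho>\<^sub>1 h"
      using int[OF inv] by simp
    also have "\<rho>\<^sub>2 k * (X * \<rho>\<^sub>1 h) * \<rho>\<^sub>1 k = \<rho>\<^sub>2 k * X * (\<rho>\<^sub>1 h * \<rho>\<^sub>1 k)"
      using X h k by (simp add: assoc)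
    also have "\<dots> = \<rho>\<^sub>2 k * X"
      using X h k by (simp add: i1)
    finally show ?case by (simp only: k_def)
  next
    case (eng g h)
    then have c: "g \<in> carrier G" "h \<in> carrier G"
      using generate_in_carrier[OF A] by auto
    have "X * \<rho>\<^sub>1 (g \<otimes>\<^bsub>G\<^esub> h) = X * \<rho>\<^sub>1 g * \<rho>\<^sub>1 h"
      using X c \<rho>1.hom_mult[OF c] by (simp add: GL_simps assoc)
    also have "\<dots> = \<rho>\<^sub>2 g * (X * \<rho>\<^sub>1 h)"
      using X c eng.IH by (simp add: assoc)
    also have "\<dots> = \<rho>\<^sub>2 (g \<otimes>\<^bsub>G\<^esub> h) * X"
      using X c eng.IH \<rho>2.hom_mult[OF c] by (simp add: GL_simps assoc)
    finally show ?case .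
  qed
qed

lemma eq_mat_on_vecI:
  fixes A B :: "'a :: comm_ring_1 mat"
  assumes A: "A \<in> carrier_mat m k" and B: "B \<in> carrier_mat m k"
    and eq: "\<And>x. x \<in> carrier_vec k \<Longrightarrow> A *\<^sub>v x = B *\<^sub>v x"
  shows "A = B"
proof (rule mat_col_eqI)
  fix j assume "j < dim_col B"
  then have j: "j < k" using B by simp
  have "col A j = A *\<^sub>v unit_vec k j" "col B j = B *\<^sub>v unit_vec k j"
    using A B j by (auto intro!: eq_vecI simp: scalar_prod_right_unit)
  then show "col A j = col B j" using eq by simp
qed (use A B in auto)

definition mat_trace :: "'a :: comm_monoid_add mat \<Rightarrow> 'a" where
  "mat_trace A = (\<Sum>j<dim_row A. A $$ (j, j))"

lemma mat_trace_comm: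
  fixes A :: "'a :: comm_semiring_0 mat"
  assumes "A \<in> carrier_mat m m" "B \<in> carrier_mat m m"
  shows "mat_trace (A * B) = mat_trace (B * A)"
proof -
  have "mat_trace (A * B) = (\<Sum>j<m. \<Sum>k<m. A $$ (j, k) * B $$ (k, j))"
    using assms by (auto simp: mat_trace_def scalar_prod_def atLeast0LessThan intro!: sum.cong)
  also have "\<dots> = (\<Sum>k<m. \<Sum>j<m. B $$ (k, j) * A $$ (j, k))"
    by (subst sum.swap) (simp add: mult.commute)
  also have "\<dots> = mat_trace (B * A)"
    using assms by (auto simp: mat_trace_def scalar_prod_def atLeast0LessThan intro!: sum.cong)
  finally show ?thesis .
qed

lemma mat_trace_transpose: "A \<in> carrier_mat m m \<Longrightarrow> mat_trace (transpose_mat A) = mat_trace A"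
  by (auto simp: mat_trace_def)

text \<open>Characters are the invariants that separate inequivalent representations below.\<close>

lemma equivalent_reps_trace_eq:
  assumes "equivalent_reps G m \<rho>\<^sub>1 \<rho>\<^sub>2" "matrix_rep G m \<rho>\<^sub>1" "matrix_rep G m \<rho>\<^sub>2" "g \<in> carrier G"
  shows "mat_trace (\<rho>\<^sub>1 g) = mat_trace (\<rho>\<^sub>2 g)"
proof -
  obtain X where X: "X \<in> carrier (GL m)" and int: "X * \<rho>\<^sub>1 g = \<rho>\<^sub>2 g * X"
    using assms by (auto simp: equivalent_reps_def)
  obtain Y where Y: "X \<in> carrier_mat m m" "Y \<in> carrier_mat m m" "Y * X = 1\<^sub>m m" "X * Y = 1\<^sub>m m"
    using X by (auto simp: carrier_GL)
  have \<rho>: "\<rho>\<^sub>1 g \<in> carrier_mat m m" "\<rho>\<^sub>2 g \<in> carrier_mat m m"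
    using assms(2-4) by (auto simp: matrix_rep_def dest!: hom_in_carrier intro!: GL_carrier_mat)
  have "\<rho>\<^sub>1 g = Y * (\<rho>\<^sub>2 g * X)"
    using Y \<rho> by (simp add: int[symmetric] assoc_mult_mat[of _ m m _ m _ m, symmetric])
  then have "mat_trace (\<rho>\<^sub>1 g) = mat_trace (\<rho>\<^sub>2 g * X * Y)"
    using mat_trace_comm[of Y m "\<rho>\<^sub>2 g * X"] Y \<rho> by simp
  also have "\<rho>\<^sub>2 g * X * Y = \<rho>\<^sub>2 g"
    using Y \<rho> by (simp add: assoc_mult_mat[of _ m m _ m _ m])
  finally show ?thesis .
qed


section \<open>Specialization of Laurent polynomials\<close>

lemma laurent_eval_superset:
  assumes "finite K" "Poly_Mapping.keys p \<subseteq> K"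
  shows "laurent_eval z p = (\<Sum>k\<in>K. Poly_Mapping.lookup p k * z powi k)"
  unfolding laurent_eval_def using assms
  by (intro sum.mono_neutral_left) (auto simp: in_keys_iff)

lemma laurent_eval_add: "laurent_eval z (p + q) = laurent_eval z p + laurent_eval z q"
proof -
  let ?K = "Poly_Mapping.keys p \<union> Poly_Mapping.keys q"
  have "Poly_Mapping.keys (p + q) \<subseteq> ?K" by (rule keys_add)
  then show ?thesis
    using laurent_eval_superset[of ?K "p + q" z] laurent_eval_superset[of ?K p z]
      laurent_eval_superset[of ?K q z]
    by (simp add: lookup_add algebra_simps sum.distrib)
qed

lemma laurent_eval_single: "laurent_eval z (Poly_Mapping.single k c) = c * z powi k"
  using laurent_eval_superset[of "{k}" "Poly_Mapping.single k c" z] by simp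

lemma laurent_eval_zero: "laurent_eval z 0 = 0"
  by (simp add: laurent_eval_def)

lemma laurent_eval_sum: "laurent_eval z (sum f A) = (\<Sum>a\<in>A. laurent_eval z (f a))"
  by (induction A rule: infinite_finite_induct) (auto simp: laurent_eval_add laurent_eval_zero)

lemma laurent_eval_one: "laurent_eval z 1 = 1"
  using laurent_eval_single[of z 0 1] by simp

text \<open>Multiplicativity of the evaluation is bilinear, so it reduces to monomials.\<close>

lemma laurent_sum_monomials:
  "(p :: laurent) = (\<Sum>k\<in>Poly_Mapping.keys p. Poly_Mapping.single k (Poly_Mapping.lookup p k))"
  by (rule poly_mapping_eqI)
     (auto simp: lookup_sum lookup_single when_def in_keys_iff)

lemma semiring_hom_laurent_eval:
  assumes "z \<noteq> 0"
  shows "semiring_hom (laurent_eval z)"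
proof (unfold_locales)
  fix p q :: laurent
  let ?s = "\<lambda>r k. Poly_Mapping.single k (Poly_Mapping.lookup r k) :: laurent"
  have "p * q = (\<Sum>k\<in>Poly_Mapping.keys p. \<Sum>l\<in>Poly_Mapping.keys q. ?s p k * ?s q l)"
    by (subst laurent_sum_monomials[of p], subst laurent_sum_monomials[of q])
       (simp add: sum_product)
  then show "laurent_eval z (p * q) = laurent_eval z p * laurent_eval z q"
    using assms
    by (simp add: laurent_eval_sum mult_single laurent_eval_single power_int_add)
       (simp add: laurent_eval_def sum_product mult_ac)
next
  show "laurent_eval z 1 = 1" by (rule laurent_eval_one)
qed (simp_all add: laurent_eval_add laurent_eval_zero)

lemma laurent_eval_tvar: "laurent_eval z tvar = z"
  by (simp add: tvar_def laurent_eval_single)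

lemma laurent_eval_tvar_inv: "laurent_eval z tvar_inv = inverse z"
  by (simp add: tvar_inv_def laurent_eval_single power_int_minus)

lemma laurent_eval_uminus: "laurent_eval z (- p) = - laurent_eval z p"
  using laurent_eval_add[of z p "- p"] by (simp add: laurent_eval_zero eq_neg_iff_add_eq_0 add.commute)


section \<open>Local three-term replacements\<close>

text \<open>A vector of length \<open>m\<close> is viewed as a sequence that lives on the positions \<open>1..m\<close> and vanishes
  elsewhere. With the boundary values \<open>0\<close> at the positions \<open>0\<close> and \<open>m + 1\<close>, the \<open>2 \<times> 2\<close> blocks of the
  first and of the last generator become instances of the \<open>3 \<times> 3\<close> pattern, and all relations can be
  checked on sequences without boundary cases.\<close>

definition node_op :: "'a :: comm_ring_1 \<times> 'a \<times> 'a \<Rightarrow> nat \<Rightarrow> (nat \<Rightarrow> 'a) \<Rightarrow> nat \<Rightarrow> 'a" where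
  "node_op = (\<lambda>(a, b, c) i f. f(i := a * f (i - 1) + b * f i + c * f (i + 1)))"

definition node_mat :: "nat \<Rightarrow> 'a :: comm_ring_1 \<times> 'a \<times> 'a \<Rightarrow> nat \<Rightarrow> 'a mat" where
  "node_mat m = (\<lambda>(a, b, c) i. mat m m (\<lambda>(j, k).
     if j + 1 = i then (if k + 1 = j then a else if k = j then b else if k = j + 1 then c else 0)
     else if j = k then 1 else 0))"

definition pad_vec :: "'a :: zero vec \<Rightarrow> nat \<Rightarrow> 'a" where
  "pad_vec x k = (if k \<in> {1..dim_vec x} then x $ (k - 1) else 0)"

lemma node_mat_carrier [simp]: "node_mat m p i \<in> carrier_mat m m"
  by (simp add: node_mat_def split: prod.splits)

lemma dim_node_mat [simp]: "dim_row (node_mat m p i) = m" "dim_col (node_mat m p i) = m"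
  by (simp_all add: node_mat_def split: prod.splits)

lemma pad_vec_inject:
  assumes "x \<in> carrier_vec m" "y \<in> carrier_vec m" "pad_vec x = pad_vec y"
  shows "x = y"
proof (rule eq_vecI)
  fix j assume "j < dim_vec y"
  then show "x $ j = y $ j"
    using fun_cong[OF assms(3), of "Suc j"] assms(1,2) by (simp add: pad_vec_def)
qed (use assms in simp)

lemma pad_vec_node_mat:
  fixes x :: "'a :: comm_ring_1 vec"
  assumes x: "x \<in> carrier_vec m" and i: "i \<in> {1..m}"
  shows "pad_vec (node_mat m p i *\<^sub>v x) = node_op p i (pad_vec x)"
proof
  fix k
  obtain a b c where p: "p = (a, b, c)" by (cases p)
  show "pad_vec (node_mat m p i *\<^sub>v x) k = node_op p i (pad_vec x) k"
  proof (cases "k \<in> {1..m}")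
    case False
    then show ?thesis
      using x i carrier_matD[OF node_mat_carrier[of m p i]]
      by (auto simp: node_op_def pad_vec_def p)
  next
    case True
    then obtain j where j: "k = Suc j" "j < m" by (cases k) auto
    have entry: "pad_vec (node_mat m p i *\<^sub>v x) k = (\<Sum>l<m. node_mat m p i $$ (j, l) * x $ l)"
      using j x carrier_matD[OF node_mat_carrier[of m p i]]
      by (simp add: pad_vec_def scalar_prod_def atLeast0LessThan)
    show ?thesis
    proof (cases "k = i")
      case False
      then have "(\<Sum>l<m. node_mat m p i $$ (j, l) * x $ l) = (\<Sum>l<m. if j = l then x $ l else 0)"
        using j by (intro sum.cong) (auto simp: node_mat_def p)
      also have "\<dots> = x $ j" using j by simp
      finally show ?thesis
        using False j x entry by (simp add: node_op_def pad_vec_def p)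
    next
      case True
      have "(\<Sum>l<m. node_mat m p i $$ (j, l) * x $ l)
          = (\<Sum>l<m. (if Suc l = j then a * x $ l else 0) + (if j = l then b * x $ l else 0)
                   + (if j + 1 = l then c * x $ l else 0))"
        using j True by (intro sum.cong) (auto simp: node_mat_def p)
      also have "\<dots> = (\<Sum>l<m. if Suc l = j then a * x $ l else 0) + b * x $ j
          + (if Suc j < m then c * x $ Suc j else 0)"
        using j by (simp add: sum.distrib)
      also have "(\<Sum>l<m. if Suc l = j then a * x $ l else 0) = (if 0 < j then a * x $ (j - 1) else 0)"
        using j by (cases j) auto
      finally show ?thesis
        using True j x entry by (auto simp: node_op_def pad_vec_def p)
    qed
  qed
qed

lemma node_op_inverse:
  fixes a :: "'a :: comm_ring_1"
  assumes i: "i > 0" and inv: "a + b * a' = 0" "b * b' = 1" "c + b * c' = 0"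
  shows "node_op (a, b, c) i (node_op (a', b', c') i f) = f"
proof
  fix k
  have *: "a * x + b * (a' * x + b' * y + c' * z) + c * z = y" for x y z
  proof -
    have "a * x + b * (a' * x + b' * y + c' * z) + c * z
        = (a + b * a') * x + (b * b') * y + (c + b * c') * z"
      by (simp add: algebra_simps)
    then show ?thesis using inv by simp
  qed
  have "i - 1 \<noteq> i" using i by simp
  then show "node_op (a, b, c) i (node_op (a', b', c') i f) k = f k"
    by (simp add: node_op_def *)
qed

lemma node_op_commute:
  fixes p q :: "'a :: comm_ring_1 \<times> 'a \<times> 'a"
  assumes "\<bar>int i - int j\<bar> \<ge> 2"
  shows "node_op p i (node_op q j f) = node_op q j (node_op p i f)"
proof -
  obtain a b c where p: "p = (a, b, c)" by (cases p)
  obtain a' b' c' where q: "q = (a', b', c')" by (cases q)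
  have "i \<noteq> j" "i - 1 \<noteq> j" "i + 1 \<noteq> j" "j - 1 \<noteq> i" "j + 1 \<noteq> i"
    using assms by auto
  then show ?thesis
    by (simp add: node_op_def p q fun_upd_twist)
qed

text \<open>In the next two lemmas the replacements with coefficients \<open>(a, b, c)\<close> at two adjacent positions
  move the replacement with coefficients \<open>(a', b', c')\<close> from one of these positions to the other. If
  the two triples agree, the condition on \<open>c'\<close> (or \<open>a'\<close>) follows from \<open>b = - (a * c)\<close> and the lemma is
  the braid relation, so all three-term relations of the welded braid group are instances.\<close>

lemma node_op_slide_up:
  fixes a :: "'a :: comm_ring_1"
  assumes i: "i > 0" and b: "b = - (a * c)" and c': "c' = c - a' * c * c - b' * c"
  shows "node_op (a, b, c) i (node_op (a, b, c) (Suc i) (node_op (a', b', c') i f))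
    = node_op (a', b', c') (Suc i) (node_op (a, b, c) i (node_op (a, b, c) (Suc i) f))"
    (is "?lhs = ?rhs")
proof -
  obtain j where j: "i = Suc j" using i by (cases i) auto
  have eq1: "a * w + b * (a' * w + b' * x + c' * y)
        + c * (a * (a' * w + b' * x + c' * y) + b * y + c * v)
      = a * w + b * x + c * (a * x + b * y + c * v)" for w x y v
    unfolding b c' by (simp add: algebra_simps)
  have eq2: "a * (a' * w + b' * x + c' * y) + b * y + c * v
      = a' * (a * w + b * x + c * (a * x + b * y + c * v)) + b' * (a * x + b * y + c * v) + c' * v"
    for w x y v
    unfolding b c' by (simp add: algebra_simps)
  show ?thesis
  proof
    fix k
    consider "k = i" | "k = Suc i" | "k \<noteq> i" "k \<noteq> Suc i" by blast
    then show "?lhs k = ?rhs k"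
    proof cases
      case 1
      with eq1[of "f j" "f i" "f (Suc i)" "f (Suc (Suc i))"] show ?thesis
        unfolding node_op_def j by simp
    next
      case 2
      with eq2[of "f j" "f i" "f (Suc i)" "f (Suc (Suc i))"] show ?thesis
        unfolding node_op_def j by simp
    qed (simp add: node_op_def)
  qed
qed

lemma node_op_slide_down:
  fixes a :: "'a :: comm_ring_1"
  assumes i: "i > 0" and b: "b = - (a * c)" and a': "a' = a - c' * a * a - b' * a"
  shows "node_op (a', b', c') i (node_op (a, b, c) (Suc i) (node_op (a, b, c) i f))
    = node_op (a, b, c) (Suc i) (node_op (a, b, c) i (node_op (a', b', c') (Suc i) f))"
    (is "?lhs = ?rhs")
proof -
  obtain j where j: "i = Suc j" using i by (cases i) auto
  have eq1: "a' * w + b' * (a * w + b * x + c * y) + c' * (a * (a * w + b * x + c * y) + b * y + c * v)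
      = a * w + b * x + c * (a' * x + b' * y + c' * v)" for w x y v
    unfolding b a' by (simp add: algebra_simps)
  have eq2: "a * (a * w + b * x + c * y) + b * y + c * v
      = a * (a * w + b * x + c * (a' * x + b' * y + c' * v)) + b * (a' * x + b' * y + c' * v) + c * v"
    for w x y v
    unfolding b a' by (simp add: algebra_simps)
  show ?thesis
  proof
    fix k
    consider "k = i" | "k = Suc i" | "k \<noteq> i" "k \<noteq> Suc i" by blast
    then show "?lhs k = ?rhs k"
    proof cases
      case 1
      with eq1[of "f j" "f i" "f (Suc i)" "f (Suc (Suc i))"] show ?thesis
        unfolding node_op_def j by simp
    next
      case 2
      with eq2[of "f j" "f i" "f (Suc i)" "f (Suc (Suc i))"] show ?thesis
        unfolding node_op_def j by simp
    qed (simp add: node_op_def)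
  qed
qed


section \<open>Representations of the welded braid group by three-term replacements\<close>

fun gen_index :: "wb_gen \<Rightarrow> nat" where
  "gen_index (Alpha i) = i" | "gen_index (Sigma i) = i"

fun gen_type :: "'b \<Rightarrow> 'b \<Rightarrow> wb_gen \<Rightarrow> 'b" where
  "gen_type p q (Alpha i) = p" | "gen_type p q (Sigma i) = q"

definition gen_op :: "'a \<times> 'a \<times> 'a \<Rightarrow> 'a \<times> 'a \<times> 'a \<Rightarrow> wb_gen \<Rightarrow> (nat \<Rightarrow> 'a :: comm_ring_1) \<Rightarrow> nat \<Rightarrow> 'a" where
  "gen_op p q s = node_op (gen_type p q s) (gen_index s)"

definition gen_mat :: "nat \<Rightarrow> 'a \<times> 'a \<times> 'a \<Rightarrow> 'a \<times> 'a \<times> 'a \<Rightarrow> wb_gen \<Rightarrow> 'a :: comm_ring_1 mat" where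
  "gen_mat m p q s = node_mat m (gen_type p q s) (gen_index s)"

lemma gen_mat_carrier [simp]: "gen_mat m p q s \<in> carrier_mat m m"
  by (simp add: gen_mat_def)

lemma gen_index_wb_gens: "s \<in> wb_gens n \<Longrightarrow> gen_index s \<in> {1..n-1}"
  by (auto simp: wb_gens_def)

lemma node_mat_inverse:
  fixes a :: "'a :: comm_ring_1"
  assumes i: "i \<in> {1..m}" and "a + b * a' = 0" "b * b' = 1" "c + b * c' = 0"
  shows "node_mat m (a, b, c) i * node_mat m (a', b', c') i = 1\<^sub>m m"
proof (rule eq_mat_on_vecI)
  fix x :: "'a vec" assume x: "x \<in> carrier_vec m"
  let ?A = "node_mat m (a, b, c) i" and ?B = "node_mat m (a', b', c') i"
  have B: "?B *\<^sub>v x \<in> carrier_vec m"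
    using x by (intro mult_mat_vec_carrier[of _ m m]) auto
  have "pad_vec (?A *\<^sub>v (?B *\<^sub>v x)) = pad_vec x"
    using i assms(2-) B x by (simp add: pad_vec_node_mat node_op_inverse)
  then have "?A *\<^sub>v (?B *\<^sub>v x) = x"
    using B x by (intro pad_vec_inject[of _ m] mult_mat_vec_carrier[of _ m m]) auto
  then show "(?A * ?B) *\<^sub>v x = 1\<^sub>m m *\<^sub>v x"
    using x by (simp add: assoc_mult_mat_vec[of _ m m _ m])
qed (auto intro: mult_carrier_mat[of _ m m])

lemma node_mat_GL:
  fixes a :: "'a :: comm_ring_1"
  assumes i: "i \<in> {1..m}" and b: "b * b' = 1"
  shows "node_mat m (a, b, c) i \<in> carrier (GL m)"
proof -
  have *: "b * (a * b') = a" "b * (b' * a) = a" for a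
    using b by (simp_all add: mult.left_commute mult.assoc[symmetric])
  let ?B = "node_mat m (- (b' * a), b', - (b' * c)) i"
  have "node_mat m (a, b, c) i * ?B = 1\<^sub>m m" "?B * node_mat m (a, b, c) i = 1\<^sub>m m"
    using b by (intro node_mat_inverse[OF i]; simp add: * mult.commute[of b' b])+
  then show ?thesis
    unfolding carrier_GL by (auto intro!: bexI[of _ ?B])
qed

text \<open>The coefficients \<open>p\<close> of the \<open>\<alpha>\<^sub>i\<close> and \<open>q\<close> of the \<open>\<sigma>\<^sub>i\<close> for which the generators, acting on
  sequences, satisfy the defining relations of the welded braid group, read from left to right or
  from right to left.\<close>

definition welded_coeffs :: "'a :: comm_ring_1 \<times> 'a \<times> 'a \<Rightarrow> 'a \<times> 'a \<times> 'a \<Rightarrow> bool" where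
  "welded_coeffs p q \<longleftrightarrow> (\<forall>n u v f. (u, v) \<in> wb_relations n \<longrightarrow>
     foldr (gen_op p q) u f = foldr (gen_op p q) v f)"

definition opposite_welded_coeffs :: "'a :: comm_ring_1 \<times> 'a \<times> 'a \<Rightarrow> 'a \<times> 'a \<times> 'a \<Rightarrow> bool" where
  "opposite_welded_coeffs p q \<longleftrightarrow> (\<forall>n u v f. (u, v) \<in> wb_relations n \<longrightarrow>
     foldr (gen_op p q) (rev u) f = foldr (gen_op p q) (rev v) f)"

lemma wb_relations_cases [consumes 1]:
  assumes "(u, v) \<in> wb_relations n"
  obtains (involution) i where "i > 0" "u = [Alpha i, Alpha i]" "v = []"
    | (commute) s t where "\<bar>int (gen_index s) - int (gen_index t)\<bar> \<ge> 2" "u = [s, t]" "v = [t, s]"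
    | (alpha_braid) i where "i > 0"
        "u = [Alpha i, Alpha (Suc i), Alpha i]" "v = [Alpha (Suc i), Alpha i, Alpha (Suc i)]"
    | (sigma_braid) i where "i > 0"
        "u = [Sigma i, Sigma (Suc i), Sigma i]" "v = [Sigma (Suc i), Sigma i, Sigma (Suc i)]"
    | (alpha_slide) i where "i > 0"
        "u = [Alpha i, Alpha (Suc i), Sigma i]" "v = [Sigma (Suc i), Alpha i, Alpha (Suc i)]"
    | (sigma_slide) i where "i > 0"
        "u = [Sigma i, Sigma (Suc i), Alpha i]" "v = [Alpha (Suc i), Sigma i, Sigma (Suc i)]"
proof -
  from assms consider
      (involution) i where "i > 0" "u = [Alpha i, Alpha i]" "v = []"
    | (aa) i j where "\<bar>int i - int j\<bar> \<ge> 2" "u = [Alpha i, Alpha j]" "v = [Alpha j, Alpha i]"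
    | (ss) i j where "\<bar>int i - int j\<bar> \<ge> 2" "u = [Sigma i, Sigma j]" "v = [Sigma j, Sigma i]"
    | (as) i j where "\<bar>int i - int j\<bar> \<ge> 2" "u = [Alpha i, Sigma j]" "v = [Sigma j, Alpha i]"
    | (alpha_braid) i where "i > 0"
        "u = [Alpha i, Alpha (Suc i), Alpha i]" "v = [Alpha (Suc i), Alpha i, Alpha (Suc i)]"
    | (sigma_braid) i where "i > 0"
        "u = [Sigma i, Sigma (Suc i), Sigma i]" "v = [Sigma (Suc i), Sigma i, Sigma (Suc i)]"
    | (alpha_slide) i where "i > 0"
        "u = [Alpha i, Alpha (Suc i), Sigma i]" "v = [Sigma (Suc i), Alpha i, Alpha (Suc i)]"
    | (sigma_slide) i where "i > 0"
        "u = [Sigma i, Sigma (Suc i), Alpha i]" "v = [Alpha (Suc i), Sigma i, Sigma (Suc i)]"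
    unfolding wb_relations_def by fastforce
  then show thesis
  proof cases
    case (aa i j)
    then show ?thesis using that(2)[of "Alpha i" "Alpha j"] by simp
  next
    case (ss i j)
    then show ?thesis using that(2)[of "Sigma i" "Sigma j"] by simp
  next
    case (as i j)
    then show ?thesis using that(2)[of "Alpha i" "Sigma j"] by simp
  qed (rule that; assumption)+
qed

lemma welded_coeffs_tilde:
  fixes t :: "'a :: comm_ring_1"
  shows "welded_coeffs (1, - 1, 1) (t, - t, 1)"
  unfolding welded_coeffs_def
proof (intro allI impI)
  fix n u v and f :: "nat \<Rightarrow> 'a"
  assume "(u, v) \<in> wb_relations n"
  then show "foldr (gen_op (1, - 1, 1) (t, - t, 1)) u f = foldr (gen_op (1, - 1, 1) (t, - t, 1)) v f"
  proof (cases rule: wb_relations_cases)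
    case involution
    then show ?thesis by (simp add: gen_op_def node_op_inverse)
  next
    case commute
    then show ?thesis by (simp add: gen_op_def node_op_commute)
  qed (simp_all add: gen_op_def node_op_slide_up)
qed

lemma opposite_welded_coeffs_hat:
  fixes t t' :: "'a :: comm_ring_1"
  assumes "t * t' = 1"
  shows "opposite_welded_coeffs (t, - 1, t') (t, - t, 1)"
  unfolding opposite_welded_coeffs_def
proof (intro allI impI)
  have [simp]: "t' * t = 1" "t * t' = 1" "t' * t * t = t" "t' * t * t' = t'"
    using assms by (simp_all add: mult.commute[of t' t])
  fix n u v and f :: "nat \<Rightarrow> 'a"
  assume "(u, v) \<in> wb_relations n"
  then show "foldr (gen_op (t, - 1, t') (t, - t, 1)) (rev u) f
      = foldr (gen_op (t, - 1, t') (t, - t, 1)) (rev v) f"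
  proof (cases rule: wb_relations_cases)
    case involution
    then show ?thesis by (simp add: gen_op_def node_op_inverse)
  next
    case commute
    then show ?thesis by (simp add: gen_op_def node_op_commute)
  qed (simp_all add: gen_op_def node_op_slide_down)
qed

lemma word_value_pos_word: "word_value (GL m) f (pos_word u) = foldr (\<lambda>s M. f s * M) u (1\<^sub>m m)"
  by (induction u) (simp_all add: pos_word_def GL_simps)

lemma mat_prod_carrier:
  assumes "\<And>s. f s \<in> carrier_mat m m"
  shows "foldr (\<lambda>s M. f s * M) u (1\<^sub>m m) \<in> carrier_mat m m"
  by (induction u) (auto intro!: mult_carrier_mat[of _ m m] assms)

text \<open>A product of generator matrices acts on padded vectors by the composite of the replacements, so
  identities between words in the replacements become identities between matrices.\<close>

lemma pad_vec_gen_mat_prod: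
  fixes x :: "'a :: comm_ring_1 vec"
  assumes x: "x \<in> carrier_vec m" and u: "\<And>s. s \<in> set u \<Longrightarrow> gen_index s \<in> {1..m}"
  shows "pad_vec (foldr (\<lambda>s M. gen_mat m p q s * M) u (1\<^sub>m m) *\<^sub>v x)
    = foldr (gen_op p q) u (pad_vec x)"
  using u
proof (induction u)
  case Nil
  then show ?case using x by simp
next
  case (Cons s u)
  let ?M = "foldr (\<lambda>s M. gen_mat m p q s * M) u (1\<^sub>m m)"
  have M: "?M \<in> carrier_mat m m" by (rule mat_prod_carrier) simp
  have "(gen_mat m p q s * ?M) *\<^sub>v x = gen_mat m p q s *\<^sub>v (?M *\<^sub>v x)"
    using M x by (intro assoc_mult_mat_vec[of _ m m _ m]) auto
  moreover have "?M *\<^sub>v x \<in> carrier_vec m"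
    using M x by (intro mult_mat_vec_carrier[of _ m m]) auto
  ultimately show ?case
    using Cons by (simp add: gen_mat_def gen_op_def pad_vec_node_mat)
qed

lemma gen_mat_prod_eqI:
  assumes "\<And>s. s \<in> set u \<union> set v \<Longrightarrow> gen_index s \<in> {1..m}"
    and "\<And>f. foldr (gen_op p q) u f = foldr (gen_op p q) v f"
  shows "foldr (\<lambda>s M. gen_mat m p q s * M) u (1\<^sub>m m) = foldr (\<lambda>s M. gen_mat m p q s * M) v (1\<^sub>m m)"
    (is "?prod u = ?prod v")
proof (rule eq_mat_on_vecI)
  show M: "?prod u \<in> carrier_mat m m" "?prod v \<in> carrier_mat m m"
    by (rule mat_prod_carrier; simp)+
  fix x :: "'a vec" assume x: "x \<in> carrier_vec m"
  show "?prod u *\<^sub>v x = ?prod v *\<^sub>v x"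
  proof (rule pad_vec_inject)
    show "pad_vec (?prod u *\<^sub>v x) = pad_vec (?prod v *\<^sub>v x)"
      using pad_vec_gen_mat_prod[OF x, of u p q] pad_vec_gen_mat_prod[OF x, of v p q] assms
      by simp
  qed (use M x in \<open>auto intro!: mult_mat_vec_carrier[of _ m m]\<close>)
qed

text \<open>Transposition reverses products; this is why the matrices with the coefficients in columns
  require the relations to be read from right to left.\<close>

lemma transpose_gen_mat_prod:
  "foldr (\<lambda>s M. transpose_mat (gen_mat m p q s) * M) u (1\<^sub>m m)
    = transpose_mat (foldr (\<lambda>s M. gen_mat m p q s * M) (rev u) (1\<^sub>m m))"
proof (induction u)
  case (Cons s u)
  let ?prod = "\<lambda>u M. foldr (\<lambda>s M. gen_mat m p q s * M) u M"
  have append: "?prod w M = ?prod w (1\<^sub>m m) * M" if "M \<in> carrier_mat m m" for w M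
    using that
  proof (induction w)
    case (Cons s w)
    then show ?case
      using mat_prod_carrier[of "gen_mat m p q" m w]
      by (simp add: assoc_mult_mat[of _ m m _ m _ m])
  qed simp
  have "?prod (rev (s # u)) (1\<^sub>m m) = ?prod (rev u) (1\<^sub>m m) * gen_mat m p q s"
    using append[of "gen_mat m p q s" "rev u"] by (simp add: right_mult_one_mat[of _ m m])
  then show ?case
    using Cons.IH mat_prod_carrier[of "gen_mat m p q" m "rev u"]
    by (simp add: transpose_mult[of _ m m _ m])
qed simp

lemma wb_relations_gens:
  assumes "(u, v) \<in> wb_relations n"
  shows "set u \<union> set v \<subseteq> wb_gens n"
  using assms by (auto simp: wb_relations_def wb_gens_def)

lemma row_relations:
  assumes "welded_coeffs p q" "(u, v) \<in> wb_rel_words (Suc m)"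
  shows "word_value (GL m) (gen_mat m p q) u = word_value (GL m) (gen_mat m p q) v"
proof -
  obtain u' v' where uv: "(u', v') \<in> wb_relations (Suc m)" "u = pos_word u'" "v = pos_word v'"
    using assms(2) by (auto simp: wb_rel_words_def)
  have "gen_index s \<in> {1..m}" if "s \<in> set u' \<union> set v'" for s
    using wb_relations_gens[OF uv(1)] gen_index_wb_gens[of s "Suc m"] that by auto
  moreover have "foldr (gen_op p q) u' f = foldr (gen_op p q) v' f" for f
    using assms(1) uv(1) unfolding welded_coeffs_def by blast
  ultimately show ?thesis
    unfolding uv(2,3) word_value_pos_word by (rule gen_mat_prod_eqI)
qed

lemma column_relations:
  assumes "opposite_welded_coeffs p q" "(u, v) \<in> wb_rel_words (Suc m)"
  shows "word_value (GL m) (\<lambda>s. transpose_mat (gen_mat m p q s)) u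
    = word_value (GL m) (\<lambda>s. transpose_mat (gen_mat m p q s)) v"
proof -
  obtain u' v' where uv: "(u', v') \<in> wb_relations (Suc m)" "u = pos_word u'" "v = pos_word v'"
    using assms(2) by (auto simp: wb_rel_words_def)
  have "gen_index s \<in> {1..m}" if "s \<in> set (rev u') \<union> set (rev v')" for s
    using wb_relations_gens[OF uv(1)] gen_index_wb_gens[of s "Suc m"] that by auto
  moreover have "foldr (gen_op p q) (rev u') f = foldr (gen_op p q) (rev v') f" for f
    using assms(1) uv(1) unfolding opposite_welded_coeffs_def by blast
  ultimately have "foldr (\<lambda>s M. gen_mat m p q s * M) (rev u') (1\<^sub>m m)
      = foldr (\<lambda>s M. gen_mat m p q s * M) (rev v') (1\<^sub>m m)"
    by (rule gen_mat_prod_eqI)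
  then show ?thesis
    unfolding uv(2,3) word_value_pos_word transpose_gen_mat_prod by simp
qed

lemma diag_block_mat_Cons_index:
  assumes "j < dim_row A + dim_row (diag_block_mat As)" "k < dim_col A + dim_col (diag_block_mat As)"
  shows "diag_block_mat (A # As) $$ (j, k) =
    (if j < dim_row A then if k < dim_col A then A $$ (j, k) else 0
     else if k < dim_col A then 0 else diag_block_mat As $$ (j - dim_row A, k - dim_col A))"
  using assms by (auto simp: Let_def)

lemma diag_block_mat_single: "diag_block_mat [A] = A"
  by (rule eq_matI) (auto simp: Let_def)

lemma mat_of_rows_list_2_index:
  "j < 2 \<Longrightarrow> k < 2 \<Longrightarrow> mat_of_rows_list 2 [[a, b], [c, d]] $$ (j, k)
    = (if j = 0 then if k = 0 then a else b else if k = 0 then c else d)"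
  by (auto simp: mat_of_rows_list_def dest!: less_2_cases)

lemma mat_of_rows_list_3_index:
  "j < 3 \<Longrightarrow> k < 3 \<Longrightarrow> mat_of_rows_list 3 [[a, b, c], [d, e, f], [g, h, l]] $$ (j, k)
    = (if j = 0 then if k = 0 then a else if k = 1 then b else c
       else if j = 1 then if k = 0 then d else if k = 1 then e else f
       else if k = 0 then g else if k = 1 then h else l)"
  by (auto simp: mat_of_rows_list_def numeral_3_eq_3 less_Suc_eq)

lemma burau_shape_index:
  assumes m: "m \<ge> 2" and i: "i \<in> {1..m}" and j: "j < m" and k: "k < m"
    and A: "length A = 2" and B: "length B = 3" and C: "length C = 2"
  shows "burau_shape (Suc m) A B C i $$ (j, k) =
    (if i = 1 then if j < 2 \<and> k < 2 then mat_of_rows_list 2 A $$ (j, k) else of_bool (j = k)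
     else if i = m then
       if j \<ge> m - 2 \<and> k \<ge> m - 2 then mat_of_rows_list 2 C $$ (j - (m - 2), k - (m - 2))
       else of_bool (j = k)
     else if i - 2 \<le> j \<and> j \<le> i \<and> i - 2 \<le> k \<and> k \<le> i
       then mat_of_rows_list 3 B $$ (j - (i - 2), k - (i - 2)) else of_bool (j = k))"
proof -
  have dims: "dim_row (mat_of_rows_list 2 A) = 2" "dim_col (mat_of_rows_list 2 A) = 2"
    "dim_row (mat_of_rows_list 2 C) = 2" "dim_col (mat_of_rows_list 2 C) = 2"
    "dim_row (mat_of_rows_list 3 B) = 3" "dim_col (mat_of_rows_list 3 B) = 3"
    using A B C by (simp_all add: mat_of_rows_list_def)
  consider "i = 1" | "i \<noteq> 1" "i = m" | "1 < i" "i < m" using i by force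
  then show ?thesis
  proof cases
    case 1
    then show ?thesis
      using m j k by (simp add: burau_shape_def diag_block_mat_Cons_index diag_block_mat_single dims
          del: diag_block_mat.simps) auto
  next
    case 2
    then show ?thesis
      using m j k by (simp add: burau_shape_def diag_block_mat_Cons_index diag_block_mat_single dims
          del: diag_block_mat.simps)
  next
    case 3
    then show ?thesis
      using m j k by (simp add: burau_shape_def diag_block_mat_Cons_index diag_block_mat_single dims
          dim_diag_block_mat del: diag_block_mat.simps) auto
  qed
qed

lemma burau_shape_dim:
  assumes "m \<ge> 2" "i \<in> {1..m}" "length A = 2" "length B = 3" "length C = 2"
  shows "dim_row (burau_shape (Suc m) A B C i) = m" "dim_col (burau_shape (Suc m) A B C i) = m"
  using assms by (auto simp: burau_shape_def dim_diag_block_mat mat_of_rows_list_def)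

lemma burau_shape_row:
  assumes "m \<ge> 2" "i \<in> {1..m}"
  shows "burau_shape (Suc m) [[b, c], [0, 1]] [[1, 0, 0], [a, b, c], [0, 0, 1]] [[1, 0], [a, b]] i
    = node_mat m (a, b, c) i" (is "?lhs = ?rhs")
proof (rule eq_matI)
  fix j k
  assume "j < dim_row (node_mat m (a, b, c) i)" "k < dim_col (node_mat m (a, b, c) i)"
  then have jk: "j < m" "k < m" by (simp_all add: node_mat_def)
  note index = burau_shape_index node_mat_def mat_of_rows_list_2_index
    mat_of_rows_list_3_index
  consider "i = 1" | r where "i = r + 2" "m = r + 2" | r where "i = r + 2" "r + 2 < m"
    using assms by (cases "i = 1"; cases "i = m") (auto dest!: le_Suc_ex simp: numeral_2_eq_2 less_eq_Suc_le)
  then show "?lhs $$ (j, k) = ?rhs $$ (j, k)"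
  proof cases
    case 1
    moreover have "j = 0 \<or> j = 1 \<or> j > 1" "k = 0 \<or> k = 1 \<or> k > 1" by auto
    ultimately show ?thesis using assms(1) jk by (elim disjE) (simp_all add: index)
  next
    case (2 r)
    moreover from this have "j < r \<or> j = r \<or> j = r + 1" "k < r \<or> k = r \<or> k = r + 1"
      using jk by auto
    ultimately show ?thesis using jk by (elim disjE) (simp_all add: index)
  next
    case (3 r)
    moreover have "j < r \<or> j = r \<or> j = r + 1 \<or> j = r + 2 \<or> j > r + 2"
      "k < r \<or> k = r \<or> k = r + 1 \<or> k = r + 2 \<or> k > r + 2" by auto
    ultimately show ?thesis using jk by (elim disjE) (simp_all add: index)
  qed
qed (use assms in \<open>simp_all add: burau_shape_dim node_mat_def\<close>)

lemma burau_shape_column: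
  assumes "m \<ge> 2" "i \<in> {1..m}"
  shows "burau_shape (Suc m) [[b, 0], [c, 1]] [[1, a, 0], [0, b, 0], [0, c, 1]] [[1, a], [0, b]] i
    = transpose_mat (node_mat m (a, b, c) i)" (is "?lhs = ?rhs")
proof (rule eq_matI)
  fix j k
  assume "j < dim_row (transpose_mat (node_mat m (a, b, c) i))" "k < dim_col (transpose_mat (node_mat m (a, b, c) i))"
  then have jk: "j < m" "k < m" by (simp_all add: node_mat_def)
  note index = burau_shape_index node_mat_def mat_of_rows_list_2_index
    mat_of_rows_list_3_index
  consider "i = 1" | r where "i = r + 2" "m = r + 2" | r where "i = r + 2" "r + 2 < m"
    using assms by (cases "i = 1"; cases "i = m") (auto dest!: le_Suc_ex simp: numeral_2_eq_2 less_eq_Suc_le)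
  then show "?lhs $$ (j, k) = ?rhs $$ (j, k)"
  proof cases
    case 1
    moreover have "j = 0 \<or> j = 1 \<or> j > 1" "k = 0 \<or> k = 1 \<or> k > 1" by auto
    ultimately show ?thesis using assms(1) jk by (elim disjE) (simp_all add: index)
  next
    case (2 r)
    moreover from this have "j < r \<or> j = r \<or> j = r + 1" "k < r \<or> k = r \<or> k = r + 1"
      using jk by auto
    ultimately show ?thesis using jk by (elim disjE) (simp_all add: index)
  next
    case (3 r)
    moreover have "j < r \<or> j = r \<or> j = r + 1 \<or> j = r + 2 \<or> j > r + 2"
      "k < r \<or> k = r \<or> k = r + 1 \<or> k = r + 2 \<or> k > r + 2" by auto
    ultimately show ?thesis using jk by (elim disjE) (simp_all add: index)
  qed
qed (use assms in \<open>simp_all add: burau_shape_dim node_mat_def\<close>)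


section \<open>The two extensions of the reduced Burau representation\<close>

lemma gen_mat_GL:
  assumes "fst (snd p) dvd 1" "fst (snd q) dvd 1" "s \<in> wb_gens (Suc m)"
  shows "gen_mat m p q s \<in> carrier (GL m)"
proof -
  have "gen_index s \<in> {1..m}" using gen_index_wb_gens[OF assms(3)] by simp
  moreover have "fst (snd (gen_type p q s)) dvd 1" using assms by (cases s) auto
  then obtain b' where "fst (snd (gen_type p q s)) * b' = 1" by (metis dvd_def)
  moreover obtain a b c where "gen_type p q s = (a, b, c)" by (cases "gen_type p q s")
  ultimately show ?thesis unfolding gen_mat_def by (simp add: node_mat_GL)
qed

lemma map_on_wb_gens:
  assumes f: "f \<in> wb_gens n \<rightarrow> carrier (GL m)"
    and rel: "\<And>u v. (u, v) \<in> wb_rel_words n \<Longrightarrow> word_value (GL m) f u = word_value (GL m) f v"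
  shows "map_on_gens (GL m) (wb_gens n) f \<in> hom (WB n) (GL m)"
    and "s \<in> wb_gens n \<Longrightarrow> map_on_gens (GL m) (wb_gens n) f (wb_elem n s) = f s"
proof -
  interpret group "GL m :: 'a mat monoid" by (rule group_GL)
  show "map_on_gens (GL m) (wb_gens n) f \<in> hom (WB n) (GL m)"
    unfolding WB_def by (rule map_on_gens_hom[OF f wb_rel_words_subset rel])
  assume s: "s \<in> wb_gens n"
  then have "f s \<in> carrier (GL m)" using f by auto
  then show "map_on_gens (GL m) (wb_gens n) f (wb_elem n s) = f s"
    unfolding wb_elem_def using s
    by (subst map_on_gens_class[OF f wb_rel_words_subset rel subset_refl]) auto
qed

lemma tilde_burau_eq:
  assumes "m \<ge> 2"
  shows "tilde_burau (Suc m)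
    = map_on_gens (GL m) (wb_gens (Suc m)) (gen_mat m (1, - 1, 1) (tvar, - tvar, 1))"
  unfolding tilde_burau_def diff_Suc_1
  by (rule map_on_gens_cong)
     (auto simp: wb_gens_def tilde_alpha_def tilde_sigma_def gen_mat_def burau_shape_row assms)

lemma hat_burau_eq:
  assumes "m \<ge> 2"
  shows "hat_burau (Suc m) = map_on_gens (GL m) (wb_gens (Suc m))
    (\<lambda>s. transpose_mat (gen_mat m (tvar, - 1, tvar_inv) (tvar, - tvar, 1) s))"
  unfolding hat_burau_def diff_Suc_1
  by (rule map_on_gens_cong)
     (auto simp: wb_gens_def hat_alpha_def burau_sigma_def gen_mat_def burau_shape_column assms)

lemma burau_eq:
  assumes "m \<ge> 2"
  shows "burau (Suc m) = map_on_gens (GL m) (sigma_gens (Suc m))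
    (\<lambda>s. transpose_mat (gen_mat m (tvar, - 1, tvar_inv) (tvar, - tvar, 1) s))"
  unfolding burau_def diff_Suc_1
  by (rule map_on_gens_cong)
     (auto simp: sigma_gens_def burau_sigma_def gen_mat_def burau_shape_column assms)

lemma tvar_dvd_1: "- tvar dvd 1"
  using dvdI[of 1 "- tvar" "- tvar_inv"] by (simp add: tvar_mult_tvar_inv)

lemma tilde_gens_GL: "gen_mat m (1, - 1, 1) (tvar, - tvar, 1) \<in> wb_gens (Suc m) \<rightarrow> carrier (GL m)"
  by (intro Pi_I gen_mat_GL) (use tvar_dvd_1 in auto)

lemma hat_gens_GL:
  "(\<lambda>s. transpose_mat (gen_mat m (tvar, - 1, tvar_inv) (tvar, - tvar, 1) s))
    \<in> wb_gens (Suc m) \<rightarrow> carrier (GL m)"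
  by (intro Pi_I GL_transpose gen_mat_GL) (use tvar_dvd_1 in auto)

lemma
  assumes "m \<ge> 2"
  shows tilde_burau_hom: "tilde_burau (Suc m) \<in> hom (WB (Suc m)) (GL m)"
    and tilde_burau_gen: "s \<in> wb_gens (Suc m) \<Longrightarrow>
      tilde_burau (Suc m) (wb_elem (Suc m) s) = gen_mat m (1, - 1, 1) (tvar, - tvar, 1) s"
    and hat_burau_hom: "hat_burau (Suc m) \<in> hom (WB (Suc m)) (GL m)"
    and hat_burau_gen: "s \<in> wb_gens (Suc m) \<Longrightarrow> hat_burau (Suc m) (wb_elem (Suc m) s)
      = transpose_mat (gen_mat m (tvar, - 1, tvar_inv) (tvar, - tvar, 1) s)"
  unfolding tilde_burau_eq[OF assms] hat_burau_eq[OF assms]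
  by (intro map_on_wb_gens[OF tilde_gens_GL row_relations[OF welded_coeffs_tilde]]
      map_on_wb_gens[OF hat_gens_GL
        column_relations[OF opposite_welded_coeffs_hat[OF tvar_mult_tvar_inv]]]; assumption)+

text \<open>Every element of the braid group is represented by a word in the \<open>Sigma i\<close> alone, on whose
  letters \<open>burau\<close> and \<open>hat_burau\<close> take the same values.\<close>

lemma burau_eq_hat_burau:
  assumes "m \<ge> 2" "g \<in> carrier (braid_group (Suc m))"
  shows "burau (Suc m) g = hat_burau (Suc m) g"
proof -
  interpret group "GL m :: laurent mat monoid" by (rule group_GL)
  obtain w where w: "w \<in> words (sigma_gens (Suc m))"
    "g = pres_rel (wb_gens (Suc m)) (wb_rel_words (Suc m)) `` {w}"
    using assms(2) by (auto simp: carrier_braid_group_eq)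
  let ?f = "\<lambda>s. transpose_mat (gen_mat m (tvar, - 1, tvar_inv) (tvar, - tvar, 1) s)"
  have eval: "map_on_gens (GL m) T ?f (pres_rel (wb_gens (Suc m)) (wb_rel_words (Suc m)) `` {w})
      = word_value (GL m) ?f w" if "T \<subseteq> wb_gens (Suc m)" "w \<in> words T" for T
    using that column_relations[OF opposite_welded_coeffs_hat[OF tvar_mult_tvar_inv]]
    by (intro map_on_gens_class[OF hat_gens_GL wb_rel_words_subset]) auto
  have "w \<in> words (wb_gens (Suc m))"
    using w(1) words_mono[OF sigma_gens_subset] by auto
  then show ?thesis
    unfolding burau_eq[OF assms(1)] hat_burau_eq[OF assms(1)] w(2)
    using eval[OF sigma_gens_subset w(1)] eval[OF subset_refl] by simp
qed


section \<open>Specializations\<close>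

lemma map_mat_node_mat:
  assumes "semiring_hom h"
  shows "map_mat h (node_mat m (a, b, c) i) = node_mat m (h a, h b, h c) i"
proof -
  interpret semiring_hom h by fact
  show ?thesis by (rule eq_matI) (auto simp: node_mat_def)
qed

lemma map_mat_gen_mat:
  assumes "semiring_hom h"
  shows "map_mat h (gen_mat m (a, b, c) (a', b', c') s) = gen_mat m (h a, h b, h c) (h a', h b', h c') s"
  by (cases s) (simp_all add: gen_mat_def map_mat_node_mat[OF assms])

lemma map_mat_transpose: "map_mat h (transpose_mat A) = transpose_mat (map_mat h A)"
  by (rule eq_matI) auto

lemma specialize_hom:
  assumes "z \<noteq> 0" "\<rho> \<in> hom G (GL m)"
  shows "specialize z \<rho> \<in> hom G (GL m)"
  using hom_compose[OF assms(2) hom_map_mat_GL[OF semiring_hom_laurent_eval[OF assms(1)]]]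
  by (simp add: specialize_def[abs_def] comp_def)

lemmas laurent_eval_simps =
  laurent_eval_one laurent_eval_uminus laurent_eval_tvar laurent_eval_tvar_inv

lemma
  assumes "m \<ge> 2" "z \<noteq> 0"
  shows tilde_burau_at_hom: "tilde_burau_at (Suc m) z \<in> hom (WB (Suc m)) (GL m)"
    and hat_burau_at_hom: "hat_burau_at (Suc m) z \<in> hom (WB (Suc m)) (GL m)"
  by (intro specialize_hom assms tilde_burau_hom hat_burau_hom)+

lemma
  assumes "m \<ge> 2" "z \<noteq> 0" "s \<in> wb_gens (Suc m)"
  shows tilde_burau_at_gen:
      "tilde_burau_at (Suc m) z (wb_elem (Suc m) s) = gen_mat m (1, - 1, 1) (z, - z, 1) s"
    and hat_burau_at_gen: "hat_burau_at (Suc m) z (wb_elem (Suc m) s)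
      = transpose_mat (gen_mat m (z, - 1, inverse z) (z, - z, 1) s)"
  using assms
  by (simp_all add: specialize_def tilde_burau_gen hat_burau_gen map_mat_transpose
      map_mat_gen_mat[OF semiring_hom_laurent_eval] laurent_eval_simps)


section \<open>A symmetric intertwiner\<close>

text \<open>The specialized \<open>\<sigma>\<^sub>i\<close> act in one representation by \<open>1 + e\<^sub>i c\<^sub>i\<^sup>T\<close> and in the other by
  \<open>1 + c\<^sub>i e\<^sub>i\<^sup>T\<close>, where \<open>c\<^sub>i = z e\<^sub>i\<^sub>-\<^sub>1 - (1 + z) e\<^sub>i + e\<^sub>i\<^sub>+\<^sub>1\<close>. The equation
  \<open>X e\<^sub>i c\<^sub>i\<^sup>T = c\<^sub>i e\<^sub>i\<^sup>T X\<close> for an intertwiner \<open>X\<close> says that the \<open>i\<close>-th column and the \<open>i\<close>-th row of \<open>X\<close>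
  are the same multiple of \<open>c\<^sub>i\<close>. The factors \<open>z\<^sup>1\<^sup>-\<^sup>i\<close>
  turn the tridiagonal matrix with columns \<open>c\<^sub>i\<close> into a symmetric one, as this requires.\<close>

definition burau_form :: "nat \<Rightarrow> complex \<Rightarrow> complex mat" where
  "burau_form m z = mat m m (\<lambda>(j, k).
     if j = k then - (1 + z) * inverse z ^ j
     else if k = j + 1 then inverse z ^ j else if j = k + 1 then inverse z ^ k else 0)"

lemma burau_form_carrier [simp]: "burau_form m z \<in> carrier_mat m m"
  by (simp add: burau_form_def)

lemma dim_burau_form [simp]: "dim_row (burau_form m z) = m" "dim_col (burau_form m z) = m"
  by (simp_all add: burau_form_def)

lemma burau_form_sym:
  "j < m \<Longrightarrow> k < m \<Longrightarrow> burau_form m z $$ (j, k) = burau_form m z $$ (k, j)"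
  by (auto simp: burau_form_def)

lemma transpose_burau_form: "transpose_mat (burau_form m z) = burau_form m z"
  by (rule eq_matI) (auto simp: burau_form_sym burau_form_def)

text \<open>Each \<open>\<sigma>\<^sub>i\<close> is a rank-one perturbation of the identity, and the perturbation is a multiple of a row of
  the form; this is how the form enters all computations with the \<open>\<sigma>\<^sub>i\<close>.\<close>

lemma node_mat_sigma_index:
  assumes "z \<noteq> 0" "i \<in> {1..m}" "j < m" "k < m"
  shows "node_mat m (z, - z, 1) i $$ (j, k)
    = of_bool (j = k) + of_bool (j = i - 1) * z ^ (i - 1) * burau_form m z $$ (i - 1, k)"
proof (cases "j = i - 1")
  case True
  then have i: "i = Suc j" using assms by auto
  show ?thesis
  proof (cases j)
    case 0
    with i show ?thesis using assms by (auto simp: node_mat_def burau_form_def)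
  next
    case (Suc l)
    with i show ?thesis using assms
      by (auto simp: node_mat_def burau_form_def field_simps)
  qed
next
  case False
  then show ?thesis using assms by (auto simp: node_mat_def)
qed

text \<open>Since the form \<open>X\<close> is symmetric, \<open>X R = R\<^sup>T X\<close> says that \<open>X R\<close> is symmetric, and \<open>X R\<close> is \<open>X\<close> plus a
  multiple of \<open>x x\<^sup>T\<close> for a column \<open>x\<close> of \<open>X\<close>.\<close>

lemma burau_form_intertwines:
  assumes z: "z \<noteq> 0" and i: "i \<in> {1..m}"
  shows "burau_form m z * node_mat m (z, - z, 1) i
    = transpose_mat (node_mat m (z, - z, 1) i) * burau_form m z"
proof -
  let ?X = "burau_form m z" and ?R = "node_mat m (z, - z, 1) i"
  have index: "(?X * ?R) $$ (j, k)
      = ?X $$ (j, k) + z ^ (i - 1) * ?X $$ (j, i - 1) * ?X $$ (i - 1, k)"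
    if "j < m" "k < m" for j k
  proof -
    have "(?X * ?R) $$ (j, k) = (\<Sum>l<m. ?X $$ (j, l) * ?R $$ (l, k))"
      using that carrier_matD[OF burau_form_carrier[of m z]]
        carrier_matD[OF node_mat_carrier[of m "(z, - z, 1)" i]]
      by (simp add: scalar_prod_def atLeast0LessThan)
    also have "\<dots> = (\<Sum>l<m. (if l = k then ?X $$ (j, l) else 0)
        + (if l = i - 1 then z ^ (i - 1) * ?X $$ (j, l) * ?X $$ (l, k) else 0))"
      using that by (intro sum.cong refl) (auto simp: node_mat_sigma_index[OF z i] algebra_simps)
    also have "\<dots> = ?X $$ (j, k) + z ^ (i - 1) * ?X $$ (j, i - 1) * ?X $$ (i - 1, k)"
      using that i by (auto simp: sum.distrib)
    finally show ?thesis .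
  qed
  have "transpose_mat (?X * ?R) = ?X * ?R"
  proof (rule eq_matI)
    fix j k assume "j < dim_row (?X * ?R)" "k < dim_col (?X * ?R)"
    then have jk: "j < m" "k < m"
      using carrier_matD[OF burau_form_carrier[of m z]]
        carrier_matD[OF node_mat_carrier[of m "(z, - z, 1)" i]] by auto
    have sym: "(?X * ?R) $$ (k, j) = (?X * ?R) $$ (j, k)"
      using index[OF jk] index[OF jk(2) jk(1)] i burau_form_sym[OF jk, of z]
        burau_form_sym[of j m "i - 1" z] burau_form_sym[of k m "i - 1" z] jk
      by auto
    have "?X * ?R \<in> carrier_mat m m" by (rule mult_carrier_mat[of _ m m]) auto
    then show "transpose_mat (?X * ?R) $$ (j, k) = (?X * ?R) $$ (j, k)"
      using jk sym by simp
  qed (use carrier_matD[OF burau_form_carrier[of m z]]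
        carrier_matD[OF node_mat_carrier[of m "(z, - z, 1)" i]] in auto)
  then show ?thesis
    by (simp add: transpose_mult[of _ m m _ m] transpose_burau_form)
qed

lemma burau_form_kernel_fixed:
  assumes z: "z \<noteq> 0" and i: "i \<in> {1..m}" and x: "x \<in> carrier_vec m"
    and zero: "burau_form m z *\<^sub>v x = 0\<^sub>v m"
  shows "node_mat m (z, - z, 1) i *\<^sub>v x = x"
proof (rule eq_vecI)
  let ?X = "burau_form m z" and ?R = "node_mat m (z, - z, 1) i"
  show "dim_vec (?R *\<^sub>v x) = dim_vec x"
    using x carrier_matD[OF node_mat_carrier[of m "(z, - z, 1)" i]] by simp
  fix j assume "j < dim_vec x"
  then have j: "j < m" using x by simp
  have "(\<Sum>k<m. ?X $$ (i - 1, k) * x $ k) = (?X *\<^sub>v x) $ (i - 1)"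
    using i x carrier_matD[OF burau_form_carrier[of m z]]
    by (auto simp: scalar_prod_def atLeast0LessThan)
  then have form0: "(\<Sum>k<m. ?X $$ (i - 1, k) * x $ k) = 0"
    using i by (auto simp: zero)
  have "(?R *\<^sub>v x) $ j = (\<Sum>k<m. ?R $$ (j, k) * x $ k)"
    using j x carrier_matD[OF node_mat_carrier[of m "(z, - z, 1)" i]]
    by (simp add: scalar_prod_def atLeast0LessThan)
  also have "\<dots> = (\<Sum>k<m. (if k = j then x $ k else 0)
      + of_bool (j = i - 1) * z ^ (i - 1) * (?X $$ (i - 1, k) * x $ k))"
    using j by (intro sum.cong refl) (auto simp: node_mat_sigma_index[OF z i] algebra_simps)
  also have "\<dots> = x $ j + of_bool (j = i - 1) * z ^ (i - 1) * (\<Sum>k<m. ?X $$ (i - 1, k) * x $ k)"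
    using j by (simp add: sum.distrib sum_distrib_left)
  finally show "(?R *\<^sub>v x) $ j = x $ j" using form0 by simp
qed

lemma P_poly_0 [simp]: "P_poly 0 z = 0"
  by (simp add: P_poly_def)

lemma P_poly_recurrence: "P_poly (Suc (Suc k)) z = P_poly (Suc k) z + z * (P_poly (Suc k) z - P_poly k z)"
  by (simp add: P_poly_def)

text \<open>A vector in the kernel of the form is fixed by all \<open>\<sigma>\<^sub>i\<close>, so its consecutive differences are
  multiplied by \<open>z\<close> at every step. Starting from the boundary value \<open>0\<close>, its entry at position \<open>k\<close> is
  the first entry times \<open>P_poly k z\<close>, and the boundary value at position \<open>m + 1\<close> must be \<open>0\<close> again.\<close>

lemma burau_form_GL:
  assumes z: "z \<noteq> 0" and P: "P_poly (Suc m) z \<noteq> 0"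
  shows "burau_form m z \<in> carrier (GL m)"
proof (rule GL_if_det_nonzero)
  show "det (burau_form m z) \<noteq> 0"
  proof
    assume "det (burau_form m z) = 0"
    then obtain x where x: "x \<in> carrier_vec m" "x \<noteq> 0\<^sub>v m" "burau_form m z *\<^sub>v x = 0\<^sub>v m"
      using det_0_iff_vec_prod_zero_field[OF burau_form_carrier] by blast
    define f where "f = pad_vec x"
    have step: "f (Suc (Suc k)) = f (Suc k) + z * (f (Suc k) - f k)" if "k < m" for k
    proof -
      have k: "Suc k \<in> {1..m}" using that by simp
      have "node_op (z, - z, 1) (Suc k) f = f"
        using pad_vec_node_mat[OF x(1) k, of "(z, - z, 1)"] burau_form_kernel_fixed[OF z k x(1,3)]
        by (simp add: f_def)
      from fun_cong[OF this, of "Suc k"] show ?thesis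
        by (simp add: node_op_def algebra_simps)
    qed
    have f: "f k = f 1 * P_poly k z \<and> f (Suc k) = f 1 * P_poly (Suc k) z" if "k \<le> m" for k
      using that
    proof (induction k)
      case 0
      then show ?case by (simp add: f_def pad_vec_def P_poly_def)
    next
      case (Suc k)
      then have IH: "f k = f 1 * P_poly k z" "f (Suc k) = f 1 * P_poly (Suc k) z" by auto
      have "f (Suc (Suc k)) = f 1 * P_poly (Suc (Suc k)) z"
        using step[of k] Suc.prems unfolding P_poly_recurrence IH by (simp add: algebra_simps)
      with IH(2) show ?case by simp
    qed
    have "f (Suc m) = 0" using x(1) by (simp add: f_def pad_vec_def)
    then have "f 1 = 0" using f[of m] P by simp
    then have f0: "f k = 0" if "k \<le> m" for k
      using f[OF that] by simp
    have "x = 0\<^sub>v m"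
    proof (rule eq_vecI)
      fix j assume "j < dim_vec (0\<^sub>v m)"
      then show "x $ j = 0\<^sub>v m $ j"
        using f0[of "Suc j"] x(1) by (simp add: f_def pad_vec_def)
    qed (use x in auto)
    then show False using x by simp
  qed
qed simp


section \<open>Irreducibility of the Burau representation\<close>

text \<open>If \<open>w\<close> in an invariant subspace has a nonzero entry at position \<open>i\<close>, then \<open>\<sigma>\<^sub>i w - w\<close> is a nonzero
  multiple of the corresponding column of the form, which hence lies in the subspace. The neighbouring
  entries of that column are nonzero, so the columns of all positions follow, and they span because the
  form is invertible.\<close>

lemma burau_form_invariant_subspace:
  assumes z: "z \<noteq> 0" and P: "P_poly (Suc m) z \<noteq> 0"
    and W: "W \<subseteq> carrier_vec m" "0\<^sub>v m \<in> W"
    and add: "\<And>v w. v \<in> W \<Longrightarrow> w \<in> W \<Longrightarrow> v + w \<in> W"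
    and smult: "\<And>c w. w \<in> W \<Longrightarrow> c \<cdot>\<^sub>v w \<in> W"
    and inv: "\<And>i w. i \<in> {1..m} \<Longrightarrow> w \<in> W \<Longrightarrow> transpose_mat (node_mat m (z, - z, 1) i) *\<^sub>v w \<in> W"
  shows "W = {0\<^sub>v m} \<or> W = carrier_vec m"
proof -
  let ?X = "burau_form m z"
  have col_in: "col ?X j \<in> W" if w: "w \<in> W" and j: "j < m" "w $ j \<noteq> 0" for w j
  proof -
    let ?R = "transpose_mat (node_mat m (z, - z, 1) (Suc j))"
    have wc: "w \<in> carrier_vec m" using W w by auto
    \<comment> \<open>the coefficient of the column of the form in \<open>\<sigma>\<^sub>i w - w\<close>\<close>
    define d where "d = z ^ j * w $ j"
    have d: "d \<noteq> 0" using z j by (simp add: d_def)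
    have i: "Suc j \<in> {1..m}" using j by simp
    define u where "u = ?R *\<^sub>v w"
    have uW: "u \<in> W" using inv[OF i w] by (simp add: u_def)
    then have uc: "u \<in> carrier_vec m" using W by auto
    have u: "u $ k = w $ k + d * ?X $$ (k, j)" if k: "k < m" for k
    proof -
      have "u $ k = (\<Sum>l<m. node_mat m (z, - z, 1) (Suc j) $$ (l, k) * w $ l)"
        using k wc by (simp add: u_def scalar_prod_def atLeast0LessThan)
      also have "\<dots> = (\<Sum>l<m. (if l = k then w $ l else 0)
          + (if l = j then z ^ j * ?X $$ (j, k) * w $ l else 0))"
        using k by (intro sum.cong refl) (auto simp: node_mat_sigma_index[OF z i] algebra_simps)
      also have "\<dots> = w $ k + z ^ j * ?X $$ (j, k) * w $ j"
        using k j by (simp add: sum.distrib)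
      finally show ?thesis
        using burau_form_sym[OF k j(1), of z] by (simp add: d_def)
    qed
    have "col ?X j = inverse d \<cdot>\<^sub>v (u + (- 1) \<cdot>\<^sub>v w)"
    proof (rule eq_vecI)
      fix k assume "k < dim_vec (inverse d \<cdot>\<^sub>v (u + (- 1) \<cdot>\<^sub>v w))"
      then have "k < m" using wc by simp
      then show "col ?X j $ k = (inverse d \<cdot>\<^sub>v (u + (- 1) \<cdot>\<^sub>v w)) $ k"
        using wc uc j d u[of k] by simp
    qed (use wc in simp)
    moreover have "inverse d \<cdot>\<^sub>v (u + (- 1) \<cdot>\<^sub>v w) \<in> W"
      by (intro smult add uW w)
    ultimately show ?thesis by simp
  qed
  show ?thesis
  proof (cases "W = {0\<^sub>v m}")
    case False
    then obtain w where w: "w \<in> W" "w \<noteq> 0\<^sub>v m" using W by auto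
    have wc: "dim_vec w = m" using w W by auto
    have "\<exists>j<m. w $ j \<noteq> 0"
    proof (rule ccontr)
      assume "\<not> (\<exists>j<m. w $ j \<noteq> 0)"
      then have "w = 0\<^sub>v m" using wc by (intro eq_vecI) auto
      then show False using w by simp
    qed
    then obtain j where j: "j < m" "col ?X j \<in> W" using col_in[OF w(1)] by blast
    have up: "col ?X (Suc k) \<in> W" if "col ?X k \<in> W" "Suc k < m" for k
    proof (rule col_in[OF that])
      show "col ?X k $ Suc k \<noteq> 0" using that(2) z by (simp add: burau_form_def)
    qed
    have down: "col ?X k \<in> W" if "col ?X (Suc k) \<in> W" "Suc k < m" for k
    proof (rule col_in[OF that(1)])
      show "col ?X (Suc k) $ k \<noteq> 0" using that(2) z by (simp add: burau_form_def)
    qed (use that in simp)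
    have "0 < m" using j by simp
    have "col ?X 0 \<in> W" using j
    proof (induction j)
      case (Suc j) then show ?case using down[of j] by simp
    qed simp
    then have col: "col ?X k \<in> W" if "k < m" for k
      using that
    proof (induction k)
      case (Suc k) then show ?case using up[of k] by simp
    qed simp
    have X_in: "?X *\<^sub>v y \<in> W" if y: "y \<in> carrier_vec m" for y
    proof -
      \<comment> \<open>the partial sums of \<open>X y\<close> as a linear combination of columns\<close>
      define v where "v k = vec m (\<lambda>r. \<Sum>l<k. ?X $$ (r, l) * y $ l)" for k
      have "v k \<in> W" if "k \<le> m" for k
        using that
      proof (induction k)
        case 0
        have "v 0 = 0\<^sub>v m" by (rule eq_vecI) (auto simp: v_def)
        then show ?case using W by simp
      next
        case (Suc k)
        have "v (Suc k) = v k + y $ k \<cdot>\<^sub>v col ?X k"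
          using Suc.prems by (intro eq_vecI) (auto simp: v_def)
        then show ?case using Suc add smult col by simp
      qed
      moreover have "?X *\<^sub>v y = v m"
        using y by (intro eq_vecI) (auto simp: v_def scalar_prod_def atLeast0LessThan)
      ultimately show ?thesis by simp
    qed
    obtain Y where Y: "Y \<in> carrier_mat m m" "?X * Y = 1\<^sub>m m"
      using burau_form_GL[OF z P] by (auto simp: carrier_GL)
    have "v \<in> W" if v: "v \<in> carrier_vec m" for v
    proof -
      have "Y *\<^sub>v v \<in> carrier_vec m" using Y v by (intro mult_mat_vec_carrier[of _ m m])
      moreover have "?X *\<^sub>v (Y *\<^sub>v v) = v"
        using Y v by (simp add: assoc_mult_mat_vec[of _ m m _ m, symmetric])
      ultimately show ?thesis using X_in[of "Y *\<^sub>v v"] by simp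
    qed
    then show ?thesis using W by auto
  qed simp
qed

lemma restrict_hom_braid_group:
  assumes "\<rho> \<in> hom (WB n) H"
  shows "\<rho> \<in> hom (braid_group n) H"
  using assms carrier_braid_group_subset[of n]
  by (auto simp: hom_def braid_group_def Pi_iff)

lemma burau_at_eq_hat_burau_at:
  assumes "m \<ge> 2" "g \<in> carrier (braid_group (Suc m))"
  shows "burau_at (Suc m) z g = hat_burau_at (Suc m) z g"
  using burau_eq_hat_burau[OF assms] by (simp add: specialize_def)

lemma burau_at_hom:
  assumes "m \<ge> 2" "z \<noteq> 0"
  shows "burau_at (Suc m) z \<in> hom (braid_group (Suc m)) (GL m)"
proof -
  have "hat_burau_at (Suc m) z \<in> hom (braid_group (Suc m)) (GL m)"
    by (rule restrict_hom_braid_group[OF hat_burau_at_hom[OF assms]])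
  then show ?thesis
    using monoid.m_closed[OF group.is_monoid[OF group_braid_group[of "Suc m"]]]
    by (simp add: hom_def Pi_iff burau_at_eq_hat_burau_at[OF assms(1)])
qed

lemma wb_elem_sigma_braid_group: "s \<in> sigma_gens n \<Longrightarrow> wb_elem n s \<in> carrier (braid_group n)"
  by (auto simp: braid_group_def intro: generate.incl)

lemma irreducible_burau_at:
  assumes m: "m \<ge> 2" and z: "z \<noteq> 0" and P: "P_poly (Suc m) z \<noteq> 0"
  shows "irreducible_rep (braid_group (Suc m)) m (burau_at (Suc m) z)"
  unfolding irreducible_rep_def matrix_rep_def
proof (intro conjI allI impI)
  show "burau_at (Suc m) z \<in> hom (braid_group (Suc m)) (GL m)"
    by (rule burau_at_hom[OF m z])
  show "m > 0" using m by simp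
  fix W
  assume "VectorSpace.subspace class_ring W (module_vec TYPE(complex) m) \<and>
    (\<forall>g \<in> carrier (braid_group (Suc m)). \<forall>w \<in> W. burau_at (Suc m) z g *\<^sub>v w \<in> W)"
  then have sub: "submodule class_ring W (module_vec TYPE(complex) m)"
    and inv: "\<And>g w. g \<in> carrier (braid_group (Suc m)) \<Longrightarrow> w \<in> W \<Longrightarrow> burau_at (Suc m) z g *\<^sub>v w \<in> W"
    by (auto simp: VectorSpace.subspace_def)
  show "W = {0\<^sub>v m} \<or> W = carrier_vec m"
  proof (rule burau_form_invariant_subspace[OF z P])
    show "W \<subseteq> carrier_vec m" "0\<^sub>v m \<in> W"
      using submodule.subset[OF sub] submodule.zero_closed[OF sub] by (simp_all add: module_vec_simps)
    show "v + w \<in> W" if "v \<in> W" "w \<in> W" for v w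
      using submodule.m_closed[OF sub that] by (simp add: module_vec_simps)
    show "c \<cdot>\<^sub>v w \<in> W" if "w \<in> W" for c w
      using submodule.smult_closed[OF sub _ that, of c] by (simp add: module_vec_simps)
    fix i w assume i: "i \<in> {1..m}" and w: "w \<in> W"
    have s: "Sigma i \<in> sigma_gens (Suc m)" using i by (simp add: sigma_gens_def)
    then have "burau_at (Suc m) z (wb_elem (Suc m) (Sigma i))
        = transpose_mat (node_mat m (z, - z, 1) i)"
      using sigma_gens_subset[of "Suc m"] m z
      by (simp add: burau_at_eq_hat_burau_at wb_elem_sigma_braid_group hat_burau_at_gen
          gen_mat_def subset_iff)
    then show "transpose_mat (node_mat m (z, - z, 1) i) *\<^sub>v w \<in> W"
      using inv[OF wb_elem_sigma_braid_group[OF s] w] by simp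
  qed
qed


section \<open>Equivalences and characters\<close>

lemma tilde_hat_equivalent_on_braid_group:
  assumes m: "m \<ge> 2" and z: "z \<noteq> 0" and P: "P_poly (Suc m) z \<noteq> 0"
  shows "equivalent_reps (braid_group (Suc m)) m (tilde_burau_at (Suc m) z) (hat_burau_at (Suc m) z)"
  unfolding equivalent_reps_def
proof (intro bexI ballI)
  show "burau_form m z \<in> carrier (GL m)" by (rule burau_form_GL[OF z P])
  fix g assume "g \<in> carrier (braid_group (Suc m))"
  then have g: "g \<in> generate (WB (Suc m)) (wb_elem (Suc m) ` sigma_gens (Suc m))"
    by (simp add: braid_group_def)
  show "burau_form m z * tilde_burau_at (Suc m) z g = hat_burau_at (Suc m) z g * burau_form m z"
  proof (rule intertwines_generate[OF group_WB tilde_burau_at_hom[OF m z] hat_burau_at_hom[OF m z]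
        burau_form_carrier _ _ g])
    show "wb_elem (Suc m) ` sigma_gens (Suc m) \<subseteq> carrier (WB (Suc m))"
      using sigma_gens_subset wb_elem_closed by blast
    fix h assume "h \<in> wb_elem (Suc m) ` sigma_gens (Suc m)"
    then obtain i where "h = wb_elem (Suc m) (Sigma i)" "i \<in> {1..m}"
      by (auto simp: sigma_gens_def)
    moreover from this have "Sigma i \<in> wb_gens (Suc m)" by (simp add: wb_gens_def)
    ultimately show "burau_form m z * tilde_burau_at (Suc m) z h
        = hat_burau_at (Suc m) z h * burau_form m z"
      using burau_form_intertwines[OF z, of i m]
      by (simp add: tilde_burau_at_gen[OF m z] hat_burau_at_gen[OF m z] gen_mat_def)
  qed
qed

text \<open>At \<open>z = 1\<close> the coefficients of \<open>\<alpha>\<^sub>i\<close> and \<open>\<sigma>\<^sub>i\<close> coincide in both representations, so the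
  intertwiner for the \<open>\<sigma>\<^sub>i\<close> also works for the \<open>\<alpha>\<^sub>i\<close>.\<close>

lemma tilde_hat_equivalent_at_1:
  assumes m: "m \<ge> 2"
  shows "equivalent_reps (WB (Suc m)) m (tilde_burau_at (Suc m) 1) (hat_burau_at (Suc m) 1)"
  unfolding equivalent_reps_def
proof (intro bexI ballI)
  have "P_poly (Suc m) 1 \<noteq> 0"
    using of_nat_neq_0[of m, where 'a = complex] by (simp add: P_poly_def)
  then show "burau_form m 1 \<in> carrier (GL m)" by (intro burau_form_GL) auto
  have one: "(1 :: complex) \<noteq> 0" by simp
  fix g assume "g \<in> carrier (WB (Suc m))"
  then have g: "g \<in> generate (WB (Suc m)) (wb_elem (Suc m) ` wb_gens (Suc m))"
    by (simp add: carrier_WB_eq_generate)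
  show "burau_form m 1 * tilde_burau_at (Suc m) 1 g = hat_burau_at (Suc m) 1 g * burau_form m 1"
  proof (rule intertwines_generate[OF group_WB tilde_burau_at_hom[OF m one]
        hat_burau_at_hom[OF m one] burau_form_carrier _ _ g])
    show "wb_elem (Suc m) ` wb_gens (Suc m) \<subseteq> carrier (WB (Suc m))"
      using wb_elem_closed by blast
    fix h assume "h \<in> wb_elem (Suc m) ` wb_gens (Suc m)"
    then obtain s where s: "h = wb_elem (Suc m) s" "s \<in> wb_gens (Suc m)" by auto
    have "gen_type p p s = p" for p :: "complex \<times> complex \<times> complex" by (cases s) auto
    then show "burau_form m 1 * tilde_burau_at (Suc m) 1 h
        = hat_burau_at (Suc m) 1 h * burau_form m 1"
      using burau_form_intertwines[OF one, of "gen_index s" m] gen_index_wb_gens[OF s(2)]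
      by (simp add: s tilde_burau_at_gen[OF m one] hat_burau_at_gen[OF m one] gen_mat_def)
  qed
qed

text \<open>The trace of \<open>\<sigma>\<^sub>1\<close> determines \<open>z\<close>. It does not distinguish the two extensions for the same \<open>z\<close>;
  for this a mixed product is needed, and in \<open>\<sigma>\<^sub>1 \<alpha>\<^sub>2\<close> the off-diagonal entries contribute \<open>1\<close> to the
  trace in one extension and \<open>z\<close> in the other.\<close>

lemma trace_node_mat:
  assumes "i \<in> {1..m}"
  shows "mat_trace (node_mat m (a, b, c) i) = of_nat m - 1 + (b :: 'a :: comm_ring_1)"
proof -
  have "node_mat m (a, b, c) i $$ (j, j) = 1 + (if j = i - 1 then b - 1 else 0)" if "j < m" for j
    using assms that by (auto simp: node_mat_def)
  then have "mat_trace (node_mat m (a, b, c) i) = (\<Sum>j<m. 1 + (if j = i - 1 then b - 1 else 0))"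
    using carrier_matD(1)[OF node_mat_carrier[of m "(a, b, c)" i]] by (simp add: mat_trace_def)
  also have "\<dots> = of_nat m - 1 + b"
    using assms by (auto simp: sum.distrib)
  finally show ?thesis .
qed

lemma trace_node_mat_mult:
  fixes a :: "'a :: comm_ring_1"
  assumes m: "m \<ge> 2"
  shows "mat_trace (node_mat m (a, b, c) 1 * node_mat m (a', b', c') 2)
    = of_nat m - 2 + b + b' + c * a'"
proof -
  let ?A = "node_mat m (a, b, c) 1" and ?B = "node_mat m (a', b', c') 2"
  have dims: "dim_row ?A = m" "dim_col ?A = m" "dim_row ?B = m" "dim_col ?B = m"
    by (simp_all add: node_mat_def)
  have diag: "(?A * ?B) $$ (j, j)
      = 1 + (if j = 0 then b + c * a' - 1 else 0) + (if j = 1 then b' - 1 else 0)" if j: "j < m" for j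
  proof -
    have "?B *\<^sub>v unit_vec m j = col ?B j"
      using j dims by (intro eq_vecI) (auto simp: scalar_prod_right_unit)
    then have "(?A * ?B) $$ (j, j) = pad_vec (?A *\<^sub>v (?B *\<^sub>v unit_vec m j)) (Suc j)"
      using j dims by (simp add: pad_vec_def)
    also have "\<dots> = node_op (a, b, c) 1 (node_op (a', b', c') 2 (pad_vec (unit_vec m j))) (Suc j)"
      using m by (simp add: pad_vec_node_mat[of _ m] mult_mat_vec_carrier[of _ m m])
    also have "\<dots> = 1 + (if j = 0 then b + c * a' - 1 else 0) + (if j = 1 then b' - 1 else 0)"
      using j m by (auto simp: node_op_def pad_vec_def)
    finally show ?thesis .
  qed
  have "mat_trace (?A * ?B) = (\<Sum>j<m. 1 + (if j = 0 then b + c * a' - 1 else 0)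
      + (if j = 1 then b' - 1 else 0))"
    using diag dims by (simp add: mat_trace_def)
  also have "\<dots> = of_nat m - 2 + b + b' + c * a'"
    using m by (simp add: sum.distrib algebra_simps)
  finally show ?thesis .
qed

lemma
  assumes m: "m \<ge> 2" and z: "z \<noteq> 0"
  shows trace_tilde_sigma: "mat_trace (tilde_burau_at (Suc m) z (wb_elem (Suc m) (Sigma 1)))
      = of_nat m - 1 - z"
    and trace_hat_sigma: "mat_trace (hat_burau_at (Suc m) z (wb_elem (Suc m) (Sigma 1)))
      = of_nat m - 1 - z"
    and trace_tilde_sigma_alpha: "mat_trace (tilde_burau_at (Suc m) z
      (wb_elem (Suc m) (Sigma 1) \<otimes>\<^bsub>WB (Suc m)\<^esub> wb_elem (Suc m) (Alpha 2))) = of_nat m - 2 - z"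
    and trace_hat_sigma_alpha: "mat_trace (hat_burau_at (Suc m) z
      (wb_elem (Suc m) (Sigma 1) \<otimes>\<^bsub>WB (Suc m)\<^esub> wb_elem (Suc m) (Alpha 2))) = of_nat m - 3"
proof -
  have s: "Sigma 1 \<in> wb_gens (Suc m)" "Alpha 2 \<in> wb_gens (Suc m)"
    using m by (auto simp: wb_gens_def)
  note tilde = tilde_burau_at_gen[OF m z] and hat = hat_burau_at_gen[OF m z]
  show "mat_trace (tilde_burau_at (Suc m) z (wb_elem (Suc m) (Sigma 1))) = of_nat m - 1 - z"
    using m s by (simp add: tilde gen_mat_def trace_node_mat)
  show "mat_trace (hat_burau_at (Suc m) z (wb_elem (Suc m) (Sigma 1))) = of_nat m - 1 - z"
    using m s by (simp add: hat gen_mat_def trace_node_mat mat_trace_transpose[of _ m])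
  show "mat_trace (tilde_burau_at (Suc m) z
      (wb_elem (Suc m) (Sigma 1) \<otimes>\<^bsub>WB (Suc m)\<^esub> wb_elem (Suc m) (Alpha 2))) = of_nat m - 2 - z"
    using trace_node_mat_mult[OF m, of z "- z" 1 1 "- 1" 1] s
    by (simp add: hom_mult[OF tilde_burau_at_hom[OF m z]] wb_elem_closed GL_simps tilde gen_mat_def)
  let ?A = "node_mat m (z, - z, 1) 1" and ?B = "node_mat m (z, - 1, inverse z) 2"
  have "mat_trace (transpose_mat ?A * transpose_mat ?B) = mat_trace (?B * ?A)"
    using mat_trace_transpose[of "?B * ?A" m] mult_carrier_mat[of ?B m m ?A m]
    by (simp add: transpose_mult[of _ m m _ m])
  also have "\<dots> = mat_trace (?A * ?B)"
    by (rule mat_trace_comm[of _ m]) auto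
  finally show "mat_trace (hat_burau_at (Suc m) z
      (wb_elem (Suc m) (Sigma 1) \<otimes>\<^bsub>WB (Suc m)\<^esub> wb_elem (Suc m) (Alpha 2))) = of_nat m - 3"
    using trace_node_mat_mult[OF m, of z "- z" 1 z "- 1" "inverse z"] s
    by (simp add: hom_mult[OF hat_burau_at_hom[OF m z]] wb_elem_closed GL_simps hat gen_mat_def)
qed

theorem lemma3p2:
  fixes n :: nat
  assumes "n \<ge> 3"
  shows
    "(matrix_rep (WB n) (n - 1) (tilde_burau n) \<and>
      (\<forall>i \<in> {1..n-1}. tilde_burau n (wb_elem n (Sigma i)) = tilde_sigma n i \<and>
                      tilde_burau n (wb_elem n (Alpha i)) = tilde_alpha n i) \<and>
      matrix_rep (WB n) (n - 1) (hat_burau n) \<and>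
      (\<forall>i \<in> {1..n-1}. hat_burau n (wb_elem n (Sigma i)) = burau_sigma n i \<and>
                      hat_burau n (wb_elem n (Alpha i)) = hat_alpha n i))
   \<and> (\<forall>z. z \<noteq> 0 \<longrightarrow>
        matrix_rep (WB n) (n - 1) (tilde_burau_at n z) \<and>
        matrix_rep (WB n) (n - 1) (hat_burau_at n z) \<and>
        (P_poly n z \<noteq> 0 \<longrightarrow>
          irreducible_rep (braid_group n) (n - 1) (burau_at n z) \<and>
          equivalent_reps (braid_group n) (n - 1) (tilde_burau_at n z) (burau_at n z) \<and>
          equivalent_reps (braid_group n) (n - 1) (hat_burau_at n z) (burau_at n z)))
   \<and> (\<forall>z\<^sub>1 z\<^sub>2. z\<^sub>1 \<noteq> 0 \<and> z\<^sub>2 \<noteq> 0 \<and> P_poly n z\<^sub>1 \<noteq> 0 \<and> P_poly n z\<^sub>2 \<noteq> 0 \<and> z\<^sub>1 \<noteq> z\<^sub>2 \<longrightarrow>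
        \<not> equivalent_reps (WB n) (n - 1) (tilde_burau_at n z\<^sub>1) (tilde_burau_at n z\<^sub>2) \<and>
        \<not> equivalent_reps (WB n) (n - 1) (hat_burau_at n z\<^sub>1) (hat_burau_at n z\<^sub>2) \<and>
        \<not> equivalent_reps (WB n) (n - 1) (tilde_burau_at n z\<^sub>1) (hat_burau_at n z\<^sub>2))
   \<and> (\<forall>z. z \<noteq> 0 \<and> P_poly n z \<noteq> 0 \<and> z \<noteq> 1 \<longrightarrow>
        \<not> equivalent_reps (WB n) (n - 1) (tilde_burau_at n z) (hat_burau_at n z))
   \<and> equivalent_reps (WB n) (n - 1) (tilde_burau_at n 1) (hat_burau_at n 1)"
proof -
  define m where "m = n - 1"
  have m: "m \<ge> 2" and n: "n = Suc m" "n - 1 = m" using assms by (auto simp: m_def)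
  have gens: "Sigma i \<in> wb_gens n" "Alpha i \<in> wb_gens n" if "i \<in> {1..m}" for i
    using that by (auto simp: wb_gens_def n)
  have tilde_rep: "matrix_rep (WB n) m (tilde_burau_at n z)"
    and hat_rep: "matrix_rep (WB n) m (hat_burau_at n z)" if "z \<noteq> 0" for z
    using that tilde_burau_at_hom[OF m] hat_burau_at_hom[OF m] by (simp_all add: matrix_rep_def n)
  have part1: "matrix_rep (WB n) m (tilde_burau n)" "matrix_rep (WB n) m (hat_burau n)"
    using tilde_burau_hom[OF m] hat_burau_hom[OF m] by (simp_all add: matrix_rep_def n)
  have part1_gens:
    "tilde_burau n (wb_elem n (Sigma i)) = tilde_sigma n i"
    "tilde_burau n (wb_elem n (Alpha i)) = tilde_alpha n i"
    "hat_burau n (wb_elem n (Sigma i)) = burau_sigma n i"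
    "hat_burau n (wb_elem n (Alpha i)) = hat_alpha n i" if "i \<in> {1..m}" for i
    using gens[OF that] that m unfolding n
    by (simp_all add: tilde_burau_gen hat_burau_gen gen_mat_def tilde_sigma_def tilde_alpha_def
        burau_sigma_def hat_alpha_def burau_shape_row burau_shape_column)
  have part2: "irreducible_rep (braid_group n) m (burau_at n z)"
    "equivalent_reps (braid_group n) m (tilde_burau_at n z) (burau_at n z)"
    "equivalent_reps (braid_group n) m (hat_burau_at n z) (burau_at n z)"
    if z: "z \<noteq> 0" and P: "P_poly n z \<noteq> 0" for z
  proof -
    note P = P[unfolded n]
    show "irreducible_rep (braid_group n) m (burau_at n z)"
      unfolding n by (rule irreducible_burau_at[OF m z P])
    show "equivalent_reps (braid_group n) m (tilde_burau_at n z) (burau_at n z)"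
      using tilde_hat_equivalent_on_braid_group[OF m z P]
      by (simp add: n equivalent_reps_def burau_at_eq_hat_burau_at[OF m])
    show "equivalent_reps (braid_group n) m (hat_burau_at n z) (burau_at n z)"
      unfolding equivalent_reps_def
    proof (intro bexI ballI)
      fix g assume g: "g \<in> carrier (braid_group n)"
      have "hat_burau_at n z g \<in> carrier_mat m m"
        using restrict_hom_braid_group[OF hat_burau_at_hom[OF m z]] g
        by (intro GL_carrier_mat) (auto simp: n intro: hom_in_carrier)
      then show "1\<^sub>m m * hat_burau_at n z g = burau_at n z g * 1\<^sub>m m"
        using g by (simp add: n burau_at_eq_hat_burau_at[OF m])
    qed (auto simp: carrier_GL)
  qed
  have s: "wb_elem n (Sigma 1) \<in> carrier (WB n)" "wb_elem n (Alpha 2) \<in> carrier (WB n)"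
    using m by (auto intro!: wb_elem_closed gens)
  have sa: "wb_elem n (Sigma 1) \<otimes>\<^bsub>WB n\<^esub> wb_elem n (Alpha 2) \<in> carrier (WB n)"
    using monoid.m_closed[OF group.is_monoid[OF group_WB] s] .
  have part3: "\<not> equivalent_reps (WB n) m (tilde_burau_at n z\<^sub>1) (tilde_burau_at n z\<^sub>2)"
    "\<not> equivalent_reps (WB n) m (hat_burau_at n z\<^sub>1) (hat_burau_at n z\<^sub>2)"
    "\<not> equivalent_reps (WB n) m (tilde_burau_at n z\<^sub>1) (hat_burau_at n z\<^sub>2)"
    if z: "z\<^sub>1 \<noteq> 0" "z\<^sub>2 \<noteq> 0" "z\<^sub>1 \<noteq> z\<^sub>2" for z\<^sub>1 z\<^sub>2
    using equivalent_reps_trace_eq[OF _ tilde_rep[OF z(1)] tilde_rep[OF z(2)] s(1)]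
      equivalent_reps_trace_eq[OF _ hat_rep[OF z(1)] hat_rep[OF z(2)] s(1)]
      equivalent_reps_trace_eq[OF _ tilde_rep[OF z(1)] hat_rep[OF z(2)] s(1)] z
      trace_tilde_sigma[OF m] trace_hat_sigma[OF m]
    by (auto simp: n)
  have part4: "\<not> equivalent_reps (WB n) m (tilde_burau_at n z) (hat_burau_at n z)"
    if z: "z \<noteq> 0" "z \<noteq> 1" for z
    using equivalent_reps_trace_eq[OF _ tilde_rep[OF z(1)] hat_rep[OF z(1)] sa] z(2)
      trace_tilde_sigma_alpha[OF m z(1)] trace_hat_sigma_alpha[OF m z(1)]
    by (auto simp: n)
  have part4': "equivalent_reps (WB n) m (tilde_burau_at n 1) (hat_burau_at n 1)"
    unfolding n by (rule tilde_hat_equivalent_at_1[OF m])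
  show ?thesis
    unfolding n(2)
    by (intro conjI allI impI ballI; (elim conjE)?;
        (rule part1 part1_gens tilde_rep hat_rep part2 part3 part4 part4'; assumption))
qed

end
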